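(* Let $f$ be a Steinhaus random multiplicative function and let $M_f(x)=\sum_{n\le x} f(n)/\sqrt{n}$. For any $\varepsilon>0$, almost surely \[ \limsup_{x\to\infty} \frac{|M_f(x)|}{\exp\bigl((1-\varepsilon)\sqrt{\log_2 x\,\log_4 x}\bigr)} \ge 1. \]
   Context: A Steinhaus random multiplicative function is defined by taking $(f(p))_{p \text{ prime}}$ independent random variables each uniformly distributed on the unit circle $\{z\in\mathbb{C}:|z|=1\}$, and extending completely multiplicatively: $f(n)=\prod_{p\mid n} f(p)^{v_p(n)}$, where $v_p(n)$ is the $p$-adic valuation of $n$. $\log_k$ denotes the $k$-fold iterated logarithm. *)

theory Defs
  imports "HOL-Probability.Probability" "HOL-Computational_Algebra.Primes"
begin

text \<open>
  The normalised arc length on the unit circle, as the law of \<open>exp (\<i> \<theta>)\<close> for an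
  angle \<open>\<theta>\<close> uniformly distributed on \<open>[0, 2 \<pi>)\<close>.
\<close>

definition unit_circle_measure :: "complex measure" where
  "unit_circle_measure = distr (uniform_measure lborel {0..<2 * pi}) borel cis"

text \<open>
  The value at \<open>n = 0\<close> is left unconstrained; it plays no role, since arithmetic functions
  live on the positive integers. Measurability of \<open>f p\<close> for prime \<open>p\<close> is part of
  \<^const>\<open>prob_space.indep_vars\<close>.
\<close>

definition steinhaus :: "'a measure \<Rightarrow> (nat \<Rightarrow> 'a \<Rightarrow> complex) \<Rightarrow> bool" where
  "steinhaus M f \<longleftrightarrow>
     prob_space M \<and>
     prob_space.indep_vars M (\<lambda>_. borel) f {p. prime p} \<and>
     (\<forall>p. prime p \<longrightarrow> distr M borel (f p) = unit_circle_measure) \<and>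
     (\<forall>n>0. \<forall>\<omega>\<in>space M. f n \<omega> = (\<Prod>p\<in>prime_factors n. f p \<omega> ^ multiplicity p n))"

definition weighted_sum :: "(nat \<Rightarrow> complex) \<Rightarrow> real \<Rightarrow> complex" where
  "weighted_sum g x = (\<Sum>n | 0 < n \<and> real n \<le> x. g n / complex_of_real (sqrt (real n)))"

definition iter_ln :: "nat \<Rightarrow> real \<Rightarrow> real" where
  "iter_ln k x = (ln ^^ k) x"

end

theory Submission
  imports Defs "HOL-Real_Asymp.Real_Asymp"
begin

text \<open>The constant 1 arises as follows. At \<open>s = exp (- L)\<close> with
  \<open>L = level (k + 1)\<close> the logarithm of the product has variance about
  \<open>L / 2\<close>, so a deviation of probability about \<open>1 / k\<close>, the borderline of
  divergence, has size \<open>sqrt (2 * (L / 2) * ln k) = sqrt (L * ln k)\<close>. The decisive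
  \<open>x\<close> have \<open>ln (ln x)\<close> about \<open>L\<close>, and
  \<open>ln (ln L)\<close> is asymptotic to \<open>ln k\<close>, which turns this into the square
  root of \<open>log_2 x * log_4 x\<close>. Hence constant factors may be lost in the old primes and
  in the truncation, but not in the new variance or in the exponent of the tail probability. A large
  Euler product singles out no particular \<open>x\<close>, which is why the proof runs by
  contradiction: a bound on all large partial sums is transferred to every stage. Terms with
  \<open>ln (ln n)\<close> well beyond \<open>L\<close> do no harm, because there the assumed bound
  is below a small power of \<open>ln n\<close> and is beaten by \<open>s * ln n\<close>, whose
  total contribution after summation by parts is bounded.\<close>

text \<open>
  By summation by parts, a bound on the partial sums \<open>M_f\<close> bounds the Dirichlet polynomials
  \<open>\<Sum>n\<le>N. f n / n powr (1/2 + s)\<close>. For \<open>N = exp (s powr -2)\<close> such a polynomial is within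
  distance \<open>1\<close> of the truncated Euler product over \<open>p \<le> N\<close>: the difference involves only
  \<open>n > N\<close>, so by orthogonality its second moment is tiny. The logarithm of the absolute value of
  the Euler product is a sum of independent random variables whose variance is asymptotic to
  \<open>ln (1/s) / 2\<close>, and the lower half of the law of the iterated logarithm applies to it. Along
  \<open>s = exp (- level k)\<close> the primes that are new at stage \<open>k\<close> carry almost all of the variance.
  Their contributions are independent for different \<open>k\<close>; an exponential change of
  measure and the second Borel--Cantelli lemma make them large infinitely often, while
  Chernoff's bound and the first Borel--Cantelli lemma control the old primes.
\<close>

section \<open>Truncated Euler products and sums over primes\<close>

text \<open>Kept generic because the same extension is applied to the random values, to
  \<open>\<lambda>p. real p powr a\<close> and to \<open>\<lambda>p. p\<close>; the last one
  recovers \<open>n\<close> itself.\<close>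

definition mult_ext :: "(nat \<Rightarrow> 'b::comm_semiring_1) \<Rightarrow> nat \<Rightarrow> 'b" where
  "mult_ext g n = (\<Prod>p\<in>prime_factors n. g p ^ multiplicity p n)"

definition primes_upto :: "nat \<Rightarrow> nat set" where
  "primes_upto N = {p. prime p \<and> p \<le> N}"

text \<open>Exponents are capped at \<open>N\<close>, so the set is finite and matches a product of
  truncated geometric series exactly. No question of convergence arises, at the price of missing
  large powers of small primes.\<close>

definition smooth_numbers :: "nat \<Rightarrow> nat set" where
  "smooth_numbers N = (\<lambda>h. \<Prod>p\<in>primes_upto N. p ^ h p) ` (primes_upto N \<rightarrow>\<^sub>E {..N})"

lemma primes_upto_mem: "p \<in> primes_upto N \<Longrightarrow> prime p"
  by (simp add: primes_upto_def)

lemma finite_primes_upto [simp]: "finite (primes_upto N)"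
  unfolding primes_upto_def by (rule finite_subset[of _ "{..N}"]) auto

lemma finite_smooth_numbers [simp]: "finite (smooth_numbers N)"
  unfolding smooth_numbers_def by (intro finite_imageI finite_PiE) auto

lemma mult_ext_superset:
  assumes "finite A" "prime_factors n \<subseteq> A" "\<And>p. p \<in> A \<Longrightarrow> prime p"
  shows "mult_ext g n = (\<Prod>p\<in>A. g p ^ multiplicity p n)"
  unfolding mult_ext_def
  by (rule prod.mono_neutral_left) (use assms in \<open>auto simp: prime_factors_multiplicity\<close>)

lemma multiplicity_less_self:
  fixes n p :: nat
  assumes "prime p" "n > 0"
  shows "multiplicity p n < n"
proof -
  have "multiplicity p n < 2 ^ multiplicity p n" by (rule less_exp)
  also have "\<dots> \<le> p ^ multiplicity p n"
    using prime_ge_2_nat[OF assms(1)] by (intro power_mono) auto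
  also have "\<dots> \<le> n" using assms by (intro dvd_imp_le multiplicity_dvd) auto
  finally show ?thesis .
qed

lemma multiplicity_prime_power_product:
  assumes "prime p"
  shows "multiplicity p (\<Prod>q\<in>primes_upto N. q ^ h q) = (if p \<in> primes_upto N then h p else 0)"
  by (rule multiplicity_prod_prime_powers) (use assms in \<open>auto simp: primes_upto_def\<close>)

lemma prime_power_product_pos: "(\<Prod>q\<in>primes_upto N. q ^ h q) > 0"
  by (intro prod_pos) (auto simp: primes_upto_def prime_gt_0_nat)

lemma prime_factors_prime_power_product:
  "prime_factors (\<Prod>q\<in>primes_upto N. q ^ h q) \<subseteq> primes_upto N"
  by (auto simp: prime_factors_multiplicity multiplicity_prime_power_product split: if_splits)

lemma smooth_numbers_pos: "n \<in> smooth_numbers N \<Longrightarrow> n > 0"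
  using prime_power_product_pos by (auto simp: smooth_numbers_def)

lemma mult_ext_smooth:
  assumes "n \<in> smooth_numbers N"
  shows "mult_ext g n = (\<Prod>p\<in>primes_upto N. g p ^ multiplicity p n)"
  by (rule mult_ext_superset)
     (use assms prime_factors_prime_power_product in \<open>auto simp: smooth_numbers_def primes_upto_def\<close>)

lemma inj_on_prime_power_product:
  "inj_on (\<lambda>h. \<Prod>p\<in>primes_upto N. p ^ h p) (primes_upto N \<rightarrow>\<^sub>E B)"
proof (rule inj_onI)
  fix h h' :: "nat \<Rightarrow> nat"
  assume h: "h \<in> primes_upto N \<rightarrow>\<^sub>E B" "h' \<in> primes_upto N \<rightarrow>\<^sub>E B"
    and eq: "(\<Prod>p\<in>primes_upto N. p ^ h p) = (\<Prod>p\<in>primes_upto N. p ^ h' p)"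
  have "h p = h' p" if "p \<in> primes_upto N" for p
    using multiplicity_prime_power_product[of p h N] multiplicity_prime_power_product[of p h' N] that eq
    by (auto simp: primes_upto_def)
  then show "h = h'" using h by (intro PiE_ext) auto
qed

text \<open>Expanding the product gives one term per exponent vector; unique factorisation, in the
  form \<open>inj_on_prime_power_product\<close>, turns the index set into numbers.\<close>

lemma truncated_euler_product:
  "(\<Prod>p\<in>primes_upto N. \<Sum>j\<le>N. g p ^ j) = (\<Sum>n\<in>smooth_numbers N. mult_ext g n)"
proof -
  have "(\<Prod>p\<in>primes_upto N. \<Sum>j\<le>N. g p ^ j) =
      (\<Sum>h\<in>primes_upto N \<rightarrow>\<^sub>E {..N}. \<Prod>p\<in>primes_upto N. g p ^ h p)"
    by (rule prod_sum_PiE) auto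
  also have "\<dots> = (\<Sum>h\<in>primes_upto N \<rightarrow>\<^sub>E {..N}. mult_ext g (\<Prod>p\<in>primes_upto N. p ^ h p))"
  proof (rule sum.cong[OF refl])
    fix h assume "h \<in> primes_upto N \<rightarrow>\<^sub>E {..N}"
    then show "(\<Prod>p\<in>primes_upto N. g p ^ h p) = mult_ext g (\<Prod>p\<in>primes_upto N. p ^ h p)"
      by (subst mult_ext_smooth[of _ N])
         (auto simp: smooth_numbers_def multiplicity_prime_power_product primes_upto_mem intro!: prod.cong)
  qed
  also have "\<dots> = (\<Sum>n\<in>smooth_numbers N. mult_ext g n)"
    unfolding smooth_numbers_def by (subst sum.reindex[OF inj_on_prime_power_product]) simp
  finally show ?thesis .
qed

lemma atLeastAtMost_subset_smooth_numbers: "{1..N} \<subseteq> smooth_numbers N"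
proof
  fix n assume n: "n \<in> {1..N}"
  define h where "h = restrict (\<lambda>p. multiplicity p n) (primes_upto N)"
  have sub: "prime_factors n \<subseteq> primes_upto N"
    using n by (auto simp: primes_upto_def prime_factors_dvd dest: dvd_imp_le)
  have "h \<in> primes_upto N \<rightarrow>\<^sub>E {..N}"
    using n less_imp_le[OF multiplicity_less_self[of _ n]]
    by (auto simp: h_def primes_upto_def intro: order_trans)
  moreover have "n = (\<Prod>p\<in>primes_upto N. p ^ h p)"
  proof -
    have "n = mult_ext (\<lambda>p. p) n"
      using n prime_factorization_nat[of n] by (simp add: mult_ext_def)
    also have "\<dots> = (\<Prod>p\<in>primes_upto N. p ^ multiplicity p n)"
      by (rule mult_ext_superset) (use sub in \<open>auto simp: primes_upto_def\<close>)
    finally show ?thesis by (simp add: h_def cong: prod.cong)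
  qed
  ultimately show "n \<in> smooth_numbers N" unfolding smooth_numbers_def by blast
qed

lemma mult_ext_mult: "mult_ext (\<lambda>p. a p * b p) n = mult_ext a n * mult_ext b n"
  by (simp add: mult_ext_def power_mult_distrib prod.distrib)

lemma mult_ext_cong: "(\<And>p. prime p \<Longrightarrow> a p = b p) \<Longrightarrow> mult_ext a n = mult_ext b n"
  unfolding mult_ext_def by (intro prod.cong) (use in_prime_factors_imp_prime in force)+

lemma mult_ext_of_real:
  "mult_ext (\<lambda>p. of_real (a p) :: 'b::{real_algebra_1,comm_semiring_1}) n = of_real (mult_ext a n)"
  by (simp add: mult_ext_def)

lemma mult_ext_powr:
  assumes "n > 0"
  shows "mult_ext (\<lambda>p. real p powr a) n = real n powr a"
proof -
  have "real n = (\<Prod>p\<in>prime_factors n. real p ^ multiplicity p n)"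
    using prime_factorization_nat[of n] assms
    by (metis (no_types, lifting) of_nat_power of_nat_prod prod.cong)
  also have "\<dots> powr a = (\<Prod>p\<in>prime_factors n. (real p ^ multiplicity p n) powr a)"
    by (rule prod_powr_distrib)
  also have "\<dots> = (\<Prod>p\<in>prime_factors n. (real p powr a) ^ multiplicity p n)"
    by (intro prod.cong refl) 
       (auto simp: powr_powr mult.commute prime_gt_0_nat in_prime_factors_imp_prime simp flip: powr_realpow powr_realpow')
  finally show ?thesis by (simp add: mult_ext_def)
qed

section \<open>Sums of powers over the integers and over the primes\<close>

lemma powr_telescope:
  fixes a :: real
  assumes "a > 0" "n > 0"
  shows "a * real (Suc n) powr (-1 - a) \<le> real n powr (-a) - real (Suc n) powr (-a)"
    and "real n powr (-a) - real (Suc n) powr (-a) \<le> a * real n powr (-1 - a)"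
proof -
  have "\<exists>x>real n. x < real (Suc n) \<and>
      real (Suc n) powr (-a) - real n powr (-a) = (real (Suc n) - real n) * (-a * x powr (-a - 1))"
  proof (rule MVT2)
    fix x assume "real n \<le> x" "x \<le> real (Suc n)"
    with assms show "((\<lambda>x. x powr (-a)) has_real_derivative -a * x powr (-a - 1)) (at x)"
      by (auto intro!: derivative_eq_intros)
  qed auto
  then obtain x where x: "real n < x" "x < real (Suc n)"
    and eq': "real (Suc n) powr (-a) - real n powr (-a) = (real (Suc n) - real n) * (-a * x powr (-a - 1))"
    by blast
  have "- a - 1 = -1 - a" by simp
  then have eq: "real n powr (-a) - real (Suc n) powr (-a) = a * x powr (-1 - a)"
    using eq' by (simp only: \<open>- a - 1 = -1 - a\<close>) simp
  have "real (Suc n) powr (-1 - a) \<le> x powr (-1 - a)" "x powr (-1 - a) \<le> real n powr (-1 - a)"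
    using x assms by (auto intro!: powr_mono2')
  with eq assms(1) show "a * real (Suc n) powr (-1 - a) \<le> real n powr (-a) - real (Suc n) powr (-a)"
    "real n powr (-a) - real (Suc n) powr (-a) \<le> a * real n powr (-1 - a)" by auto
qed

text \<open>The sum is compared with telescoping differences of \<open>n powr (-a)\<close>. The set
  is an arbitrary finite set beyond \<open>N\<close> because it is later the set of smooth numbers
  exceeding \<open>N\<close>.\<close>

lemma sum_powr_tail:
  fixes a :: real
  assumes "a > 0" "N > 0" "finite T" "\<And>n. n \<in> T \<Longrightarrow> n > N"
  shows "(\<Sum>n\<in>T. real n powr (-1 - a)) \<le> real N powr (-a) / a"
proof -
  define K where "K = Suc (Max (insert N T))"
  have K: "N \<le> K" "T \<subseteq> Suc ` {N..<K}"
  proof -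
    show "N \<le> K" using assms unfolding K_def by (intro le_SucI Max_ge) auto
    show "T \<subseteq> Suc ` {N..<K}"
    proof
      fix n assume n: "n \<in> T"
      then have "n \<le> Max (insert N T)" using assms by auto
      then show "n \<in> Suc ` {N..<K}" using assms(4)[OF n]
        by (intro image_eqI[of _ _ "n - 1"]) (auto simp: K_def)
    qed
  qed
  have "(\<Sum>n\<in>T. real n powr (-1 - a)) \<le> (\<Sum>n\<in>Suc ` {N..<K}. real n powr (-1 - a))"
    using K by (intro sum_mono2) auto
  also have "\<dots> = (\<Sum>n\<in>{N..<K}. real (Suc n) powr (-1 - a))"
    by (subst sum.reindex) auto
  also have "\<dots> \<le> (\<Sum>n\<in>{N..<K}. (real n powr (-a) - real (Suc n) powr (-a)) / a)"
    using assms powr_telescope(1)[of a] by (intro sum_mono) (auto simp: field_simps)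
  also have "\<dots> = (real N powr (-a) - real K powr (-a)) / a"
    using sum_Suc_diff'[OF K(1), of "\<lambda>n. - (real n powr (-a))"]
    by (simp add: sum_divide_distrib [symmetric])
  also have "\<dots> \<le> real N powr (-a) / a" using assms by (intro divide_right_mono) auto
  finally show ?thesis .
qed

lemma sum_powr_upper:
  fixes a :: real
  assumes "a > 0" "finite T" "0 \<notin> T"
  shows "(\<Sum>n\<in>T. real n powr (-1 - a)) \<le> 1 + 1 / a"
proof -
  have "(\<Sum>n\<in>T. real n powr (-1 - a)) \<le> (\<Sum>n\<in>insert 1 (T - {1}). real n powr (-1 - a))"
    using assms by (intro sum_mono2) auto
  also have "\<dots> = 1 + (\<Sum>n\<in>T - {1}. real n powr (-1 - a))"
    using assms by (subst sum.insert) auto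
  also have "(\<Sum>n\<in>T - {1}. real n powr (-1 - a)) \<le> real 1 powr (-a) / a"
  proof (rule sum_powr_tail)
    fix n assume "n \<in> T - {1}"
    then show "1 < n" using assms(3) by (cases "n = 0") auto
  qed (use assms in auto)
  finally show ?thesis by simp
qed

lemma sum_powr_lower:
  fixes a :: real
  assumes "a > 0" "N > 0"
  shows "(1 - real N powr (-a)) / a \<le> (\<Sum>n\<in>{1..N}. real n powr (-1 - a))"
proof -
  have "(1 - real N powr (-a)) / a = (\<Sum>n\<in>{1..<N}. (real n powr (-a) - real (Suc n) powr (-a)) / a)"
    using sum_Suc_diff'[of 1 N "\<lambda>n. - (real n powr (-a))"] assms
    by (simp add: sum_divide_distrib [symmetric])
  also have "\<dots> \<le> (\<Sum>n\<in>{1..<N}. real n powr (-1 - a))"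
    using powr_telescope(2)[of a] assms by (intro sum_mono) (auto simp: field_simps)
  also have "\<dots> \<le> (\<Sum>n\<in>{1..N}. real n powr (-1 - a))"
    by (intro sum_mono2) auto
  finally show ?thesis .
qed

text \<open>Rankin's trick: with \<open>a = 1 / ln N\<close> the weight \<open>p powr (-a)\<close>
  is at least \<open>exp (-1)\<close> for every \<open>p \<le> N\<close>, while the product of the
  \<open>1 + p powr (-1 - a)\<close> is at most a truncated zeta value, hence at most
  \<open>1 + ln N\<close>. The constant is crude, which is enough for the old primes.\<close>

lemma prime_sum_upper:
  assumes "N \<ge> 3"
  shows "(\<Sum>p\<in>primes_upto N. 1 / real p) \<le> 2 * exp 1 * ln (1 + ln N)"
proof -
  define a where "a = 1 / ln (real N)"
  have lnN: "ln (real N) > 0" using assms by simp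
  then have a: "a > 0" by (simp add: a_def)
  have "(\<Sum>p\<in>primes_upto N. real p powr (-1 - a) / 2) \<le> (\<Sum>p\<in>primes_upto N. ln (1 + real p powr (-1 - a)))"
  proof (rule sum_mono)
    fix p assume "p \<in> primes_upto N"
    then have "real p \<ge> 1" using prime_gt_0_nat[of p] by (simp add: primes_upto_def)
    then have *: "real p powr (-1 - a) \<le> 1" "real p powr (-1 - a) \<ge> 0"
      using powr_mono[of "-1 - a" 0 "real p"] a by auto
    have "ln (1 / (1 + real p powr (-1 - a))) \<le> 1 / (1 + real p powr (-1 - a)) - 1"
      using * by (intro ln_le_minus_one) (simp add: add_pos_nonneg)
    also have "\<dots> = - (real p powr (-1 - a) / (1 + real p powr (-1 - a)))"
    proof -
      have "1 / (1 + x) - 1 = - (x / (1 + x))" if "x \<ge> 0" for x :: real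
        using that by (simp add: field_simps)
      then show ?thesis using *(2) by blast
    qed
    finally have "real p powr (-1 - a) / (1 + real p powr (-1 - a)) \<le> ln (1 + real p powr (-1 - a))"
      using * by (simp add: ln_div add_pos_nonneg)
    moreover have "real p powr (-1 - a) / 2 \<le> real p powr (-1 - a) / (1 + real p powr (-1 - a))"
      by (intro divide_left_mono mult_pos_pos add_pos_nonneg) (use * in auto)
    ultimately show "real p powr (-1 - a) / 2 \<le> ln (1 + real p powr (-1 - a))" by linarith
  qed
  also have "\<dots> = ln (\<Prod>p\<in>primes_upto N. 1 + real p powr (-1 - a))"
    by (rule ln_prod[symmetric]) (auto simp: add_nonneg_eq_0_iff)
  also have "\<dots> \<le> ln (1 + ln N)"
  proof (rule ln_mono)
    show "0 < (\<Prod>p\<in>primes_upto N. 1 + real p powr (-1 - a))"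
      by (intro prod_pos) (auto intro: add_pos_nonneg)
    have "(\<Prod>p\<in>primes_upto N. 1 + real p powr (-1 - a)) \<le>
        (\<Prod>p\<in>primes_upto N. \<Sum>j\<le>N. (real p powr (-1 - a)) ^ j)"
    proof (rule prod_mono, intro conjI)
      fix p
      have "(\<Sum>j\<in>{0,1}. (real p powr (-1 - a)) ^ j) \<le> (\<Sum>j\<le>N. (real p powr (-1 - a)) ^ j)"
        using assms by (intro sum_mono2) auto
      then show "1 + real p powr (-1 - a) \<le> (\<Sum>j\<le>N. (real p powr (-1 - a)) ^ j)" by simp
    qed auto
    also have "\<dots> = (\<Sum>n\<in>smooth_numbers N. real n powr (-1 - a))"
      unfolding truncated_euler_product
      by (intro sum.cong refl mult_ext_powr smooth_numbers_pos)
    also have "\<dots> \<le> 1 + 1 / a"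
      using a smooth_numbers_pos by (intro sum_powr_upper) auto
    finally show "(\<Prod>p\<in>primes_upto N. 1 + real p powr (-1 - a)) \<le> 1 + ln N"
      by (simp add: a_def)
  qed
  finally have "(\<Sum>p\<in>primes_upto N. real p powr (-1 - a)) \<le> 2 * ln (1 + ln N)"
    by (simp add: sum_divide_distrib [symmetric])
  moreover have "(\<Sum>p\<in>primes_upto N. 1 / real p) \<le> (\<Sum>p\<in>primes_upto N. exp 1 * real p powr (-1 - a))"
  proof (rule sum_mono)
    fix p assume p: "p \<in> primes_upto N"
    then have p0: "real p > 0" "real p \<le> real N" using prime_gt_0_nat[of p] by (auto simp: primes_upto_def)
    then have "a * ln p \<le> 1" using lnN by (simp add: a_def)
    then have "1 \<le> exp 1 * exp (- (a * ln p))" by (simp add: exp_minus field_simps)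
    then have "1 / real p * 1 \<le> 1 / real p * (exp 1 * exp (- (a * ln p)))"
      using p0 by (intro mult_left_mono) auto
    also have "\<dots> = exp 1 * real p powr (-1 - a)"
      using p0 by (simp add: powr_def exp_diff exp_minus field_simps)
    finally show "1 / real p \<le> exp 1 * real p powr (-1 - a)" by simp
  qed
  ultimately have "(\<Sum>p\<in>primes_upto N. 1 / real p) \<le> exp 1 * (2 * ln (1 + ln N))"
    by (simp add: sum_distrib_left [symmetric]) (meson mult_left_mono exp_ge_zero order_trans)
  then show ?thesis by (simp only: mult_ac)
qed

text \<open>Here the leading coefficient must be exactly 1, since this sum gives the main variance.
  The truncated zeta sum is at least \<open>1 / (4 * s)\<close> and is also an Euler product, whose
  logarithm is the prime sum up to a convergent sum of squares. The 6 collects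
  \<open>2 * ln 2 \<le> 2\<close> and twice the bound 2 for the squares.\<close>

lemma prime_sum_lower:
  fixes s :: real
  assumes "s > 0" "N > 0" "real N powr (-2 * s) \<le> 1 / 2"
  shows "ln (1 / s) - 6 \<le> (\<Sum>p\<in>primes_upto N. real p powr (-1 - 2 * s))"
proof -
  define q where "q p = real p powr (-1 - 2 * s)" for p :: nat
  have q: "0 < q p" "q p \<le> 1 / 2" "(q p)\<^sup>2 \<le> real p powr (-1 - 1)" if "p \<in> primes_upto N" for p
  proof -
    have p: "real p \<ge> 2" using that prime_ge_2_nat[of p] by (simp add: primes_upto_def)
    show "0 < q p" using p by (simp add: q_def)
    have *: "q p \<le> real p powr (-1)" unfolding q_def using p assms by (intro powr_mono) auto
    also have "\<dots> \<le> 1 / 2" using p by (simp add: powr_minus field_simps)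
    finally show "q p \<le> 1 / 2" .
    have "(q p)\<^sup>2 \<le> (real p powr (-1))\<^sup>2" using * \<open>0 < q p\<close> by (intro power_mono) auto
    also have "\<dots> = real p powr (-1) * real p powr (-1)" by (rule power2_eq_square)
    also have "\<dots> = real p powr (-1 - 1)" by (subst powr_add [symmetric]) simp
    finally show "(q p)\<^sup>2 \<le> real p powr (-1 - 1)" .
  qed
  have "1 / (4 * s) \<le> (1 - real N powr (- (2 * s))) / (2 * s)"
    using assms by (simp add: field_simps)
  also have "\<dots> \<le> (\<Sum>n\<in>{1..N}. real n powr (-1 - 2 * s))"
    using sum_powr_lower[of "2 * s" N] assms by simp
  also have "\<dots> \<le> (\<Sum>n\<in>smooth_numbers N. real n powr (-1 - 2 * s))"
    using atLeastAtMost_subset_smooth_numbers by (intro sum_mono2) auto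
  also have "\<dots> = (\<Prod>p\<in>primes_upto N. \<Sum>j\<le>N. q p ^ j)"
    unfolding truncated_euler_product q_def
    by (intro sum.cong refl mult_ext_powr [symmetric] smooth_numbers_pos)
  also have "\<dots> \<le> (\<Prod>p\<in>primes_upto N. exp (q p + 2 * (q p)\<^sup>2))"
  proof (rule prod_mono, intro conjI)
    fix p assume p: "p \<in> primes_upto N"
    show "0 \<le> (\<Sum>j\<le>N. q p ^ j)" using q[OF p] by (intro sum_nonneg) auto
    have "(\<Sum>j\<le>N. q p ^ j) = (1 - q p ^ Suc N) / (1 - q p)"
      using q[OF p] sum_gp_basic[of "q p" N] by (simp add: field_simps)
    also have "\<dots> \<le> 1 / (1 - q p)" using q[OF p] by (intro divide_right_mono) auto
    also have "\<dots> = exp (- ln (1 - q p))" using q[OF p] by (simp add: exp_minus field_simps)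
    also have "\<dots> \<le> exp (q p + 2 * (q p)\<^sup>2)"
      using ln_one_minus_pos_lower_bound[of "q p"] q[OF p] by simp
    finally show "(\<Sum>j\<le>N. q p ^ j) \<le> exp (q p + 2 * (q p)\<^sup>2)" .
  qed
  also have "\<dots> = exp ((\<Sum>p\<in>primes_upto N. q p) + 2 * (\<Sum>p\<in>primes_upto N. (q p)\<^sup>2))"
    by (simp add: exp_sum [symmetric] sum.distrib sum_distrib_left)
  finally have "ln (1 / (4 * s)) \<le> (\<Sum>p\<in>primes_upto N. q p) + 2 * (\<Sum>p\<in>primes_upto N. (q p)\<^sup>2)"
    using assms by (subst (asm) ln_le_cancel_iff [symmetric]) auto
  moreover have "(\<Sum>p\<in>primes_upto N. (q p)\<^sup>2) \<le> (\<Sum>p\<in>primes_upto N. real p powr (-1 - 1))"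
    using q by (intro sum_mono) auto
  moreover have "(\<Sum>p\<in>primes_upto N. real p powr (-1 - 1)) \<le> 1 + 1 / 1"
    by (intro sum_powr_upper) (auto simp: primes_upto_def)
  moreover have "ln (1 / (4 * s)) = ln (1 / s) - 2 * ln 2"
    using assms ln_mult[of 2 2] by (simp add: ln_div ln_mult)
  moreover have "ln (2::real) \<le> 1" using ln_le_minus_one[of "2::real"] by simp
  ultimately show ?thesis by (simp add: q_def)
qed

section \<open>The logarithm of an Euler factor\<close>

lemma norm_Ln_one_minus_approx:
  fixes w :: complex
  assumes "norm w < 1"
  shows "norm (ln (1 - w) + w + w ^ 2 / 2) \<le> norm w ^ 3 / (1 - norm w)"
proof -
  define a where "a n = - (w ^ n) / of_nat n" for n
  have "a sums ln (1 - w)"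
    using Ln_series'[of "- w"] assms by (simp add: a_def [abs_def])
  then have "(\<lambda>n. a (n + 3)) sums (ln (1 - w) - (\<Sum>n<3. a n))"
    by (rule sums_split_initial_segment)
  also have "(\<Sum>n<3. a n) = - w - w ^ 2 / 2"
    by (simp add: a_def eval_nat_numeral)
  finally have tail: "(\<lambda>n. a (n + 3)) sums (ln (1 - w) + w + w ^ 2 / 2)"
    by (simp add: algebra_simps)
  have geo: "(\<lambda>n. norm w ^ 3 * norm w ^ n) sums (norm w ^ 3 * (1 / (1 - norm w)))"
    using assms by (intro sums_mult geometric_sums) auto
  have "norm (suminf (\<lambda>n. a (n + 3))) \<le> suminf (\<lambda>n. norm w ^ 3 * norm w ^ n)"
  proof (rule norm_suminf_le)
    fix n
    have "norm (a (n + 3)) = norm w ^ 3 * norm w ^ n / real (n + 3)"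
      by (simp add: a_def norm_divide norm_power norm_mult power_add mult_ac del: of_nat_add)
    also have "\<dots> \<le> norm w ^ 3 * norm w ^ n" 
      using mult_left_mono[of 1 "real (n + 3)" "norm w ^ 3 * norm w ^ n"] by (simp add: divide_le_eq)
    finally show "norm (a (n + 3)) \<le> norm w ^ 3 * norm w ^ n" .
  qed (use geo in \<open>auto dest: sums_summable\<close>)
  then show ?thesis using sums_unique[OF tail] sums_unique[OF geo] by simp
qed

text \<open>The truncated series is \<open>(1 - w ^ Suc m) / (1 - w)\<close>. For
  \<open>m \<ge> 2\<close> the numerator only changes the logarithm by a cubic amount, so truncation
  costs no more than the Taylor remainder of the denominator: 2 and 4 add up to 6. The hypothesis on
  \<open>w\<close> is what the prime 2 still satisfies at \<open>s = 0\<close>.\<close>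

lemma ln_norm_truncated_geometric_approx:
  fixes w :: complex
  assumes w: "(norm w)\<^sup>2 \<le> 1 / 2" and m: "2 \<le> m"
  shows "(\<Sum>j\<le>m. w ^ j) \<noteq> 0"
    and "\<bar>ln (norm (\<Sum>j\<le>m. w ^ j)) - Re w - Re (w ^ 2) / 2\<bar> \<le> 6 * norm w ^ 3"
proof -
  have r: "norm w \<le> 3 / 4"
    by (rule power2_le_imp_le) (use w in \<open>auto simp: power2_eq_square\<close>)
  have "norm (w ^ Suc m) = norm w ^ 3 * norm w ^ (m - 2)"
    using m by (simp only: norm_power power_add [symmetric]) simp
  also have "\<dots> \<le> norm w ^ 3 * 1"
    using r by (intro mult_left_mono power_le_one) auto
  finally have v3: "norm (w ^ Suc m) \<le> norm w ^ 3" by simp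
  have "norm w ^ 3 = norm w * (norm w)\<^sup>2" by (simp add: eval_nat_numeral)
  also have "\<dots> \<le> 3 / 4 * (1 / 2)" using r w by (intro mult_mono) auto
  finally have v: "norm (w ^ Suc m) < 1 / 2" using v3 by simp
  have ne: "w \<noteq> 1" "1 - w ^ Suc m \<noteq> 0"
    using r v by (auto dest: arg_cong[of _ _ norm])
  have geo: "(\<Sum>j\<le>m. w ^ j) = (1 - w ^ Suc m) / (1 - w)"
    using sum_gp_basic[of w m] ne by (simp add: field_simps)
  then show "(\<Sum>j\<le>m. w ^ j) \<noteq> 0" using ne by simp
  have "ln (norm (\<Sum>j\<le>m. w ^ j)) = Re (ln (1 - w ^ Suc m)) - Re (ln (1 - w))"
    unfolding geo norm_divide using ne by (simp add: ln_div)
  then have "ln (norm (\<Sum>j\<le>m. w ^ j)) - Re w - Re (w ^ 2) / 2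
      = Re (ln (1 - w ^ Suc m)) - Re (ln (1 - w) + w + w ^ 2 / 2)"
    by simp
  also have "\<bar>\<dots>\<bar> \<le> norm (ln (1 - w ^ Suc m)) + norm (ln (1 - w) + w + w ^ 2 / 2)"
    by (rule order_trans[OF abs_triangle_ineq4 add_mono[OF abs_Re_le_cmod abs_Re_le_cmod]])
  also have "norm (ln (1 - w ^ Suc m)) \<le> 2 * norm w ^ 3"
    using norm_Ln_le[of "- (w ^ Suc m)"] v v3 by (simp del: power_Suc)
  also have "norm (ln (1 - w) + w + w ^ 2 / 2) \<le> norm w ^ 3 / (1 - norm w)"
    using r by (intro norm_Ln_one_minus_approx) auto
  also have "\<dots> \<le> norm w ^ 3 / (1 / 4)"
    using r by (intro divide_left_mono mult_pos_pos) auto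
  finally show "\<bar>ln (norm (\<Sum>j\<le>m. w ^ j)) - Re w - Re (w ^ 2) / 2\<bar> \<le> 6 * norm w ^ 3"
    by simp
qed

lemma exp_quadratic_approx:
  fixes x :: real
  shows "\<bar>exp x - 1 - x - x\<^sup>2 / 2\<bar> \<le> exp \<bar>x\<bar> * \<bar>x\<bar> ^ 3"
proof -
  have "\<bar>exp x - (\<Sum>i\<le>2. x ^ i / fact i)\<bar> \<le> exp \<bar>x\<bar> * (\<bar>x\<bar> ^ Suc 2) / fact 2"
    using Taylor_exp_field[of x 2] by simp
  also have "(\<Sum>i\<le>2. x ^ i / fact i) = 1 + x + x\<^sup>2 / 2"
    by (simp add: eval_nat_numeral)
  also have "exp \<bar>x\<bar> * (\<bar>x\<bar> ^ Suc 2) / fact 2 \<le> exp \<bar>x\<bar> * (\<bar>x\<bar> ^ Suc 2) / 1"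
    by (intro divide_left_mono) auto
  also have "\<dots> = exp \<bar>x\<bar> * \<bar>x\<bar> ^ 3" by simp
  finally show ?thesis by (simp add: algebra_simps)
qed

text \<open>The integrand of the moment generating function is expanded so that all random terms of
  order at most two are multiples of \<open>Re z\<close> and \<open>Re (z ^ 2)\<close>, which have
  mean zero. The error keeps a factor \<open>\<bar>l\<bar>\<close> next to \<open>r ^ 3\<close>:
  summed over primes it is then \<open>O(\<bar>l\<bar>)\<close>, however many primes there
  are.\<close>

lemma exp_ln_norm_truncated_geometric_approx:
  "\<exists>C>0. \<forall>(z::complex) r l m. norm z = 1 \<longrightarrow> 0 \<le> r \<longrightarrow> r\<^sup>2 \<le> 1 / 2 \<longrightarrow> \<bar>l\<bar> \<le> 1 \<longrightarrow> 2 \<le> m \<longrightarrow>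
     \<bar>exp (l * ln (norm (\<Sum>j\<le>m. (z * of_real r) ^ j))) - 1 - l\<^sup>2 * r\<^sup>2 / 4
       - l * r * Re z - (l / 2 + l\<^sup>2 / 4) * r\<^sup>2 * Re (z ^ 2)\<bar> \<le> C * \<bar>l\<bar> * r ^ 3"
proof -
  \<comment> \<open>The summands come from the three pieces in \<open>exp_split\<close>:
    \<open>512 = 8 ^ 3\<close> from \<open>\<bar>Y\<bar> \<le> 8 * r\<close> in the remainder of the
    exponential, 6 from \<open>Y - a\<close>, and 32 from half of the 63 in
    \<open>Y2\<close>.\<close>
  define C :: real where "C = 512 * exp 8 + 6 + 32"
  have abs_triangle3: "\<bar>x + y + w\<bar> \<le> X + Y + W" if "\<bar>x\<bar> \<le> X" "\<bar>y\<bar> \<le> Y" "\<bar>w\<bar> \<le> W"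
    for x y w X Y W :: real
    using that by linarith
  have exp_split: "e - 1 - l\<^sup>2 * r\<^sup>2 / 4 - l * r * x - (l / 2 + l\<^sup>2 / 4) * r\<^sup>2 * b
       = (e - 1 - l * Y - (l * Y)\<^sup>2 / 2) + l * (Y - (r * x + r\<^sup>2 * b / 2))
         + l\<^sup>2 / 2 * (Y\<^sup>2 - r\<^sup>2 / 2 - r\<^sup>2 * b / 2)" for e l r x b Y :: real
    by (simp add: field_simps power2_eq_square)
  have main: "\<bar>exp (l * ln (norm (\<Sum>j\<le>m. (z * of_real r) ^ j))) - 1 - l\<^sup>2 * r\<^sup>2 / 4
       - l * r * Re z - (l / 2 + l\<^sup>2 / 4) * r\<^sup>2 * Re (z ^ 2)\<bar> \<le> C * \<bar>l\<bar> * r ^ 3"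
    if z: "norm z = 1" and r0: "0 \<le> r" and r2: "r\<^sup>2 \<le> 1 / 2" and l: "\<bar>l\<bar> \<le> 1" and m: "2 \<le> m"
    for z :: complex and r l :: real and m
  proof -
    define Y where "Y = ln (norm (\<Sum>j\<le>m. (z * of_real r) ^ j))"
    define a where "a = r * Re z + r\<^sup>2 * Re (z ^ 2) / 2"
    have r1: "r \<le> 1" by (rule power2_le_imp_le) (use r0 r2 in auto)
    have Ya: "\<bar>Y - a\<bar> \<le> 6 * r ^ 3"
      using ln_norm_truncated_geometric_approx(2)[of "z * of_real r" m] z r0 r2 m
      by (simp add: Y_def a_def norm_mult power_mult_distrib algebra_simps flip: of_real_power)
    have Rez: "\<bar>Re z\<bar> \<le> 1" "\<bar>Re (z ^ 2)\<bar> \<le> 1"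
      using abs_Re_le_cmod[of z] abs_Re_le_cmod[of "z ^ 2"] z by (auto simp: norm_power)
    have rr: "r ^ 3 \<le> r\<^sup>2" "r\<^sup>2 \<le> r"
      using r0 r1 power_decreasing[of 2 3 r] power_decreasing[of 1 2 r] by auto
    have rz: "\<bar>r * Re z\<bar> \<le> r" "\<bar>r\<^sup>2 * Re (z ^ 2)\<bar> \<le> r\<^sup>2"
      using Rez r0 by (auto simp: abs_mult intro!: mult_left_le)
    have "\<bar>a - r * Re z\<bar> \<le> r\<^sup>2 / 2" using rz by (simp add: a_def)
    then have Yrz: "\<bar>Y - r * Re z\<bar> \<le> 7 * r\<^sup>2" using Ya rr zero_le_power2[of r] by linarith
    have Yr: "\<bar>Y\<bar> \<le> 8 * r" using Yrz rr rz by linarith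
    have "(Re z)\<^sup>2 + (Im z)\<^sup>2 = 1" using z cmod_power2[of z] by simp
    \<comment> \<open>The double-angle formula splits the square into its mean \<open>1 / 2\<close>,
      the source of the variance, and a multiple of \<open>Re (z ^ 2)\<close>.\<close>
    then have Re2: "(Re z)\<^sup>2 = (1 + Re (z ^ 2)) / 2" by (simp add: power2_eq_square)
    have "\<bar>Y\<^sup>2 - (r * Re z)\<^sup>2\<bar> = \<bar>Y - r * Re z\<bar> * \<bar>Y + r * Re z\<bar>"
      by (simp add: abs_mult [symmetric] power2_eq_square algebra_simps)
    also have "\<dots> \<le> (7 * r\<^sup>2) * (9 * r)"
      using Yrz Yr rz(1) by (intro mult_mono) auto
    also have "\<dots> = 63 * r ^ 3" by (simp add: eval_nat_numeral)
    also have "Y\<^sup>2 - (r * Re z)\<^sup>2 = Y\<^sup>2 - r\<^sup>2 / 2 - r\<^sup>2 * Re (z ^ 2) / 2"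
      unfolding power_mult_distrib Re2 by algebra
    finally have Y2: "\<bar>Y\<^sup>2 - r\<^sup>2 / 2 - r\<^sup>2 * Re (z ^ 2) / 2\<bar> \<le> 63 * r ^ 3" .
    have lY: "\<bar>l * Y\<bar> \<le> \<bar>l\<bar> * (8 * r)"
      unfolding abs_mult using Yr by (intro mult_left_mono) auto
    also have "\<dots> \<le> 1 * (8 * 1)" using l r1 r0 by (intro mult_mono) auto
    finally have "\<bar>l * Y\<bar> \<le> 8" by simp
    then have "exp \<bar>l * Y\<bar> * \<bar>l * Y\<bar> ^ 3 \<le> exp 8 * (\<bar>l\<bar> * (8 * r)) ^ 3"
      using lY by (intro mult_mono power_mono) auto
    also have "\<dots> = 512 * exp 8 * \<bar>l\<bar> ^ 3 * r ^ 3" by (simp add: power_mult_distrib)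
    also have "\<dots> \<le> 512 * exp 8 * \<bar>l\<bar> * r ^ 3"
      using l r0 power_decreasing[of 1 3 "\<bar>l\<bar>"] by (intro mult_right_mono mult_left_mono) auto
    finally have E: "\<bar>exp (l * Y) - 1 - l * Y - (l * Y)\<^sup>2 / 2\<bar> \<le> 512 * exp 8 * \<bar>l\<bar> * r ^ 3"
      by (rule order_trans[OF exp_quadratic_approx])
    have E1: "\<bar>l * (Y - a)\<bar> \<le> 6 * \<bar>l\<bar> * r ^ 3"
      using Ya mult_left_mono[of "\<bar>Y - a\<bar>" "6 * r ^ 3" "\<bar>l\<bar>"] by (simp add: abs_mult mult_ac)
    have "\<bar>l\<^sup>2 / 2 * (Y\<^sup>2 - r\<^sup>2 / 2 - r\<^sup>2 * Re (z ^ 2) / 2)\<bar> \<le> \<bar>l\<bar> / 2 * (63 * r ^ 3)"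
      unfolding abs_mult using Y2 l power_decreasing[of 1 2 "\<bar>l\<bar>"] by (intro mult_mono) auto
    also have "\<dots> \<le> 32 * \<bar>l\<bar> * r ^ 3" using r0 by simp
    finally have E2: "\<bar>l\<^sup>2 / 2 * (Y\<^sup>2 - r\<^sup>2 / 2 - r\<^sup>2 * Re (z ^ 2) / 2)\<bar> \<le> 32 * \<bar>l\<bar> * r ^ 3" .
    have "exp (l * Y) - 1 - l\<^sup>2 * r\<^sup>2 / 4 - l * r * Re z - (l / 2 + l\<^sup>2 / 4) * r\<^sup>2 * Re (z ^ 2)
       = (exp (l * Y) - 1 - l * Y - (l * Y)\<^sup>2 / 2) + l * (Y - a)
         + l\<^sup>2 / 2 * (Y\<^sup>2 - r\<^sup>2 / 2 - r\<^sup>2 * Re (z ^ 2) / 2)"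
      unfolding a_def by (rule exp_split)
    then have "\<bar>exp (l * Y) - 1 - l\<^sup>2 * r\<^sup>2 / 4 - l * r * Re z - (l / 2 + l\<^sup>2 / 4) * r\<^sup>2 * Re (z ^ 2)\<bar>
       \<le> 512 * exp 8 * \<bar>l\<bar> * r ^ 3 + 6 * \<bar>l\<bar> * r ^ 3 + 32 * \<bar>l\<bar> * r ^ 3"
      using abs_triangle3[OF E E1 E2] by (simp only:)
    then show ?thesis unfolding Y_def C_def by (simp only: distrib_right)
  qed
  have "C > 0" by (simp add: C_def add_pos_pos)
  then show ?thesis using main by meson
qed

section \<open>A lower bound for tail probabilities and the second Borel--Cantelli lemma\<close>

text \<open>A lower bound for a Gaussian-like tail that uses only two-sided control, up to factors
  \<open>exp c\<close>, of the moment generating function. Under the measure tilted by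
  \<open>exp (l * S)\<close> the mass sits near \<open>l * V\<close>. With
  \<open>q = l\<^sup>2 * V / 2\<close>, the part of the integral in the window around
  \<open>l * V\<close> is at most \<open>exp (2 * (1 + d) * q) * prob E\<close>, while the whole is
  at least \<open>exp (q - c)\<close>; the quotient explains the exponent
  \<open>- (1 + 2 * d) * q\<close>. The range up to \<open>2 * l\<close> accommodates the tilt
  \<open>(1 + d) * l\<close>.\<close>

lemma (in prob_space) prob_ge_by_tilting:
  fixes S :: "'a \<Rightarrow> real" and V l c d :: real
  assumes [measurable]: "random_variable borel S"
    and int: "\<And>u. integrable M (\<lambda>x. exp (u * S x))"
    and l: "l > 0" and d: "0 < d" "d < 1"
    and lower: "exp (l\<^sup>2 * V / 2 - c) \<le> expectation (\<lambda>x. exp (l * S x))"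
    and upper: "\<And>u. 0 \<le> u \<Longrightarrow> u \<le> 2 * l \<Longrightarrow> expectation (\<lambda>x. exp (u * S x)) \<le> exp (u\<^sup>2 * V / 2 + c)"
  shows "exp (- (1 + 2 * d) * (l\<^sup>2 * V / 2)) * (exp (- c) - 2 * exp (c - d\<^sup>2 * (l\<^sup>2 * V / 2)))
     \<le> prob {x \<in> space M. S x \<ge> (1 - d) * (l * V)}"
proof -
  define T q where "T = l * V" and "q = l\<^sup>2 * V / 2"
  define E where "E = {x \<in> space M. S x \<ge> (1 - d) * T}"
  have [measurable]: "E \<in> events" unfolding E_def by measurable
  define g1 g2 where "g1 = exp (- d * (1 + d) * (2 * q))" and "g2 = exp (d * (1 - d) * (2 * q))"
  have lT: "l * T = 2 * q" by (simp add: T_def q_def power2_eq_square)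
  \<comment> \<open>Outside \<open>(1 - d) T \<le> S \<le> (1 + d) T\<close> the integrand is dominated by its tilts with the parameters
    \<open>(1 \<plusminus> d) l\<close>, whose expectations are smaller by the factor \<open>exp (- d\<^sup>2 q)\<close>.\<close>
  have pointwise: "exp (l * S x) \<le> exp ((1 + d) * (2 * q)) * indicator E x
      + g1 * exp ((1 + d) * l * S x) + g2 * exp ((1 - d) * l * S x)" if "x \<in> space M" for x
  proof -
    consider "S x > (1 + d) * T" | "S x < (1 - d) * T" | "(1 - d) * T \<le> S x" "S x \<le> (1 + d) * T"
      by linarith
    then show ?thesis
    proof cases
      case 1
      then have "d * l * ((1 + d) * T) \<le> d * l * S x" using d l by (intro mult_left_mono) auto
      then have "l * S x \<le> - d * (1 + d) * (2 * q) + (1 + d) * l * S x"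
        unfolding lT [symmetric] by (simp add: algebra_simps)
      then have "exp (l * S x) \<le> g1 * exp ((1 + d) * l * S x)"
        unfolding g1_def exp_add [symmetric] by simp
      then show ?thesis by (simp add: g2_def add_increasing add_increasing2)
    next
      case 2
      then have "d * l * S x \<le> d * l * ((1 - d) * T)" using d l by (intro mult_left_mono) auto
      then have "l * S x \<le> d * (1 - d) * (2 * q) + (1 - d) * l * S x"
        unfolding lT [symmetric] by (simp add: algebra_simps)
      then have "exp (l * S x) \<le> g2 * exp ((1 - d) * l * S x)"
        unfolding g2_def exp_add [symmetric] by simp
      then show ?thesis by (simp add: g1_def add_increasing add_increasing2)
    next
      case 3
      then have "l * S x \<le> l * ((1 + d) * T)" using l by (intro mult_left_mono) auto
      then have "exp (l * S x) \<le> exp ((1 + d) * (2 * q)) * indicator E x"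
        unfolding lT [symmetric] using 3 that by (simp add: E_def algebra_simps)
      then show ?thesis by (simp add: g1_def g2_def add_increasing2)
    qed
  qed
  have "exp (q - c) \<le> expectation (\<lambda>x. exp (l * S x))"
    using lower by (simp add: q_def)
  also have "\<dots> \<le> expectation (\<lambda>x. exp ((1 + d) * (2 * q)) * indicator E x
      + g1 * exp ((1 + d) * l * S x) + g2 * exp ((1 - d) * l * S x))"
    using pointwise
    by (intro integral_mono Bochner_Integration.integrable_add integrable_mult_right int
          integrable_real_indicator) (auto simp: emeasure_eq_measure)
  also have "\<dots> = exp ((1 + d) * (2 * q)) * prob E + g1 * expectation (\<lambda>x. exp ((1 + d) * l * S x))
      + g2 * expectation (\<lambda>x. exp ((1 - d) * l * S x))"
    using int by (simp add: emeasure_eq_measure)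
  also have "g1 * expectation (\<lambda>x. exp ((1 + d) * l * S x)) \<le> g1 * exp (((1 + d) * l)\<^sup>2 * V / 2 + c)"
    unfolding g1_def using l d by (intro mult_left_mono upper) auto
  also have "\<dots> = exp (q * (1 - d\<^sup>2) + c)"
    by (simp add: g1_def q_def exp_add [symmetric] power2_eq_square field_simps)
  also have "g2 * expectation (\<lambda>x. exp ((1 - d) * l * S x)) \<le> g2 * exp (((1 - d) * l)\<^sup>2 * V / 2 + c)"
    unfolding g2_def using l d by (intro mult_left_mono upper) auto
  also have "\<dots> = exp (q * (1 - d\<^sup>2) + c)"
    by (simp add: g2_def q_def exp_add [symmetric] power2_eq_square field_simps)
  finally have "exp (q - c) - 2 * exp (q * (1 - d\<^sup>2) + c) \<le> exp ((1 + d) * (2 * q)) * prob E"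
    by simp
  then have "exp (- ((1 + d) * (2 * q))) * (exp (q - c) - 2 * exp (q * (1 - d\<^sup>2) + c))
      \<le> exp (- ((1 + d) * (2 * q))) * (exp ((1 + d) * (2 * q)) * prob E)"
    by (intro mult_left_mono) auto
  also have "\<dots> = prob E" by (simp only: mult.assoc [symmetric] exp_add [symmetric]) simp
  also have "exp (- ((1 + d) * (2 * q))) * (exp (q - c) - 2 * exp (q * (1 - d\<^sup>2) + c))
      = exp (- (1 + 2 * d) * q) * (exp (- c) - 2 * exp (c - d\<^sup>2 * q))"
    by (simp add: right_diff_distrib exp_add [symmetric] mult.left_commute[of _ 2] algebra_simps)
  finally show ?thesis by (simp add: q_def E_def T_def)
qed

text \<open>\<open>A n\<close> is the event that something fails at \<open>n\<close>, so that
  failure at all \<open>n \<ge> m\<close> is an intersection of independent events. Its probability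
  is at most \<open>exp\<close> of minus the partial sums of \<open>1 - prob (A n)\<close>, which
  forces it to vanish.\<close>

lemma (in prob_space) borel_cantelli_AE2:
  assumes ind: "indep_events A UNIV"
    and div: "\<not> summable (\<lambda>n. 1 - prob (A n))"
  shows "AE x in M. \<exists>\<^sub>F n in sequentially. x \<notin> A n"
proof -
  have A [measurable]: "A n \<in> events" for n using ind by (auto simp: indep_events_def)
  have "AE x in M. \<exists>n\<ge>m. x \<notin> A n" for m :: nat
  proof (rule AE_I')
    define B where "B = (\<Inter>n\<in>{m..}. A n)"
    have B [measurable]: "B \<in> events" unfolding B_def by measurable
    have bound: "prob B \<le> exp (- (\<Sum>n<j. 1 - prob (A (n + m))))" for j
    proof (cases "j = 0")
      case False
      have "prob B \<le> prob (\<Inter>n\<in>{m..<m+j}. A n)"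
        using False by (intro finite_measure_mono sets.finite_INT) (auto simp: B_def)
      also have "\<dots> = (\<Prod>n\<in>{m..<m+j}. prob (A n))"
        using False ind by (auto simp: indep_events_def)
      also have "\<dots> = (\<Prod>n<j. prob (A (n + m)))"
        using prod.shift_bounds_nat_ivl[of "\<lambda>n. prob (A n)" 0 m j] by (simp add: atLeast0LessThan add.commute)
      also have "\<dots> \<le> (\<Prod>n<j. exp (- (1 - prob (A (n + m)))))"
      proof (intro prod_mono conjI)
        fix n show "prob (A (n + m)) \<le> exp (- (1 - prob (A (n + m))))"
          using exp_ge_add_one_self[of "- (1 - prob (A (n + m)))"] by simp
      qed auto
      finally show ?thesis by (simp add: exp_sum [symmetric] sum_negf [symmetric])
    qed auto
    have "prob B \<le> 0"
    proof (rule ccontr)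
      assume "\<not> prob B \<le> 0"
      then have B0: "prob B > 0" by simp
      have "summable (\<lambda>n. 1 - prob (A (n + m)))"
      proof (rule summableI_nonneg_bounded)
        fix j show "(\<Sum>n<j. 1 - prob (A (n + m))) \<le> - ln (prob B)"
          using bound[of j] B0 by (subst (asm) ln_le_cancel_iff [symmetric]) auto
      qed auto
      with div summable_iff_shift[of "\<lambda>n. 1 - prob (A n)" m] show False by simp
    qed
    then show "B \<in> null_sets M"
      using B measure_le_0_iff by (auto simp: null_sets_def emeasure_eq_measure)
    show "{x \<in> space M. \<not> (\<exists>n\<ge>m. x \<notin> A n)} \<subseteq> B" by (auto simp: B_def)
  qed
  then have "AE x in M. \<forall>m. \<exists>n\<ge>m. x \<notin> A n" by (simp add: AE_all_countable)
  then show ?thesis by (simp add: frequently_sequentially)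
qed

section \<open>Moment generating functions of logarithms of Euler products\<close>

text \<open>The uniform law enters through its positive moments. The modulus is 1 at every sample
  point, so the estimates below hold pointwise and need no exceptional sets.\<close>

locale steinhaus_primes = prob_space M for M :: "'a measure" +
  fixes z :: "nat \<Rightarrow> 'a \<Rightarrow> complex"
  assumes indep: "indep_vars (\<lambda>_. borel) z {p. prime p}"
    and norm_z: "prime p \<Longrightarrow> norm (z p \<omega>) = 1"
    and moment_z: "prime p \<Longrightarrow> k > 0 \<Longrightarrow> expectation (\<lambda>\<omega>. z p \<omega> ^ k) = 0"
begin

lemma measurable_z: "prime p \<Longrightarrow> random_variable borel (z p)"
  using indep by (auto simp: indep_vars_def)

text \<open>The truncation \<open>m\<close> is separate from the set of primes: old and new primes
  of one stage must share the same \<open>m\<close> and \<open>s\<close> for their logarithms to add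
  up to that of one Euler product.\<close>

definition log_factor :: "real \<Rightarrow> nat \<Rightarrow> nat \<Rightarrow> 'a \<Rightarrow> real" where
  "log_factor s m p \<omega> = ln (norm (\<Sum>j\<le>m. (z p \<omega> * of_real (real p powr (-1/2 - s))) ^ j))"

definition log_product :: "real \<Rightarrow> nat \<Rightarrow> nat set \<Rightarrow> 'a \<Rightarrow> real" where
  "log_product s m B \<omega> = (\<Sum>p\<in>B. log_factor s m p \<omega>)"

lemma measurable_log_factor: "prime p \<Longrightarrow> random_variable borel (log_factor s m p)"
  using measurable_z[of p] unfolding log_factor_def [abs_def] by measurable

lemma measurable_log_product:
  "(\<And>p. p \<in> B \<Longrightarrow> prime p) \<Longrightarrow> random_variable borel (log_product s m B)"
  using measurable_log_factor unfolding log_product_def [abs_def] by (intro borel_measurable_sum) auto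

lemma prime_powr_bounds:
  fixes s :: real
  assumes "prime p" "s \<ge> 0"
  shows "(real p powr (-1/2 - s))\<^sup>2 = real p powr (-1 - 2 * s)"
    and "(real p powr (-1/2 - s))\<^sup>2 \<le> 1 / 2"
    and "real p powr (-1/2 - s) \<le> 1"
    and "(real p powr (-1/2 - s)) ^ 3 \<le> real p powr (-1 - 1/2)"
proof -
  have p: "real p \<ge> 2" using assms prime_ge_2_nat[of p] by simp
  have pw: "(real p powr (-1/2 - s)) ^ n = real p powr (real n * (-1/2 - s))" for n
    using p by (simp add: powr_powr mult.commute flip: powr_realpow)
  show *: "(real p powr (-1/2 - s))\<^sup>2 = real p powr (-1 - 2 * s)"
    unfolding pw by (simp add: algebra_simps)
  also have "\<dots> \<le> real p powr (-1)" using p assms by (intro powr_mono) auto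
  also have "\<dots> \<le> 1 / 2" using p by (simp add: powr_minus field_simps)
  finally show "(real p powr (-1/2 - s))\<^sup>2 \<le> 1 / 2" .
  then show "real p powr (-1/2 - s) \<le> 1"
    by - (rule power2_le_imp_le, auto)
  show "(real p powr (-1/2 - s)) ^ 3 \<le> real p powr (-1 - 1/2)"
    unfolding pw using p assms by (intro powr_mono) auto
qed

lemma log_factor_bounded:
  assumes "prime p" "s \<ge> 0" "2 \<le> m"
  shows "\<bar>log_factor s m p \<omega>\<bar> \<le> 8"
proof -
  define r where "r = real p powr (-1/2 - s)"
  define w where "w = z p \<omega> * of_real r"
  have r: "0 \<le> r" "r \<le> 1" "r\<^sup>2 \<le> 1 / 2" using prime_powr_bounds[OF assms(1,2)] by (auto simp: r_def)
  have w: "norm w = r" using norm_z[OF assms(1)] r by (simp add: w_def norm_mult)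
  have "\<bar>ln (norm (\<Sum>j\<le>m. w ^ j)) - Re w - Re (w ^ 2) / 2\<bar> \<le> 6 * norm w ^ 3"
    using assms r by (intro ln_norm_truncated_geometric_approx) (auto simp: w)
  moreover have "norm w ^ 3 \<le> 1" "norm (w ^ 2) \<le> 1" "norm w \<le> 1"
    using w r by (auto simp: power_le_one norm_power)
  ultimately show ?thesis
    using abs_Re_le_cmod[of w] abs_Re_le_cmod[of "w ^ 2"]
    unfolding log_factor_def w_def r_def by linarith
qed

lemma integrable_exp_log_factor:
  assumes "prime p" "s \<ge> 0" "2 \<le> m"
  shows "integrable M (\<lambda>\<omega>. exp (u * log_factor s m p \<omega>))"
proof (rule integrable_const_bound)
  have "\<bar>u * log_factor s m p \<omega>\<bar> \<le> \<bar>u\<bar> * 8" for \<omega>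
    using log_factor_bounded[OF assms] by (simp add: abs_mult mult_left_mono)
  then show "AE \<omega> in M. norm (exp (u * log_factor s m p \<omega>)) \<le> exp (\<bar>u\<bar> * 8)"
    by (auto simp: abs_le_iff)
qed (use measurable_log_factor[OF assms(1), of s m] in measurable)

lemma indep_vars_exp_log_factor:
  assumes "B \<subseteq> {p. prime p}"
  shows "indep_vars (\<lambda>_. borel) (\<lambda>p \<omega>. exp (u * log_factor s m p \<omega>)) B"
  unfolding log_factor_def
  by (rule indep_vars_compose2[OF indep_vars_subset[OF indep assms]]) measurable

lemma
  assumes "finite B" "\<And>p. p \<in> B \<Longrightarrow> prime p" "s \<ge> 0" "2 \<le> m"
  shows expectation_exp_log_product: "expectation (\<lambda>\<omega>. exp (u * log_product s m B \<omega>))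
      = (\<Prod>p\<in>B. expectation (\<lambda>\<omega>. exp (u * log_factor s m p \<omega>)))"
    and integrable_exp_log_product: "integrable M (\<lambda>\<omega>. exp (u * log_product s m B \<omega>))"
proof -
  have *: "exp (u * log_product s m B \<omega>) = (\<Prod>p\<in>B. exp (u * log_factor s m p \<omega>))" for \<omega>
    using assms(1) by (simp add: log_product_def sum_distrib_left exp_sum)
  show "expectation (\<lambda>\<omega>. exp (u * log_product s m B \<omega>))
      = (\<Prod>p\<in>B. expectation (\<lambda>\<omega>. exp (u * log_factor s m p \<omega>)))"
    unfolding * using assms
    by (intro indep_vars_lebesgue_integral indep_vars_exp_log_factor integrable_exp_log_factor) auto
  show "integrable M (\<lambda>\<omega>. exp (u * log_product s m B \<omega>))"
    unfolding * using assms
    by (intro indep_vars_integrable indep_vars_exp_log_factor integrable_exp_log_factor) auto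
qed

text \<open>The pointwise expansion is integrated; the terms in \<open>Re z\<close> and
  \<open>Re (z ^ 2)\<close> vanish by the moment assumption with exponents 1 and 2.\<close>

lemma mgf_log_factor:
  "\<exists>C>0. \<forall>p s m l. prime p \<longrightarrow> s \<ge> 0 \<longrightarrow> 2 \<le> m \<longrightarrow> \<bar>l\<bar> \<le> 1 \<longrightarrow>
     \<bar>expectation (\<lambda>\<omega>. exp (l * log_factor s m p \<omega>)) - 1 - l\<^sup>2 * real p powr (-1 - 2 * s) / 4\<bar>
       \<le> C * \<bar>l\<bar> * (real p powr (-1/2 - s)) ^ 3"
proof -
  obtain C :: real where C: "C > 0" and bound:
    "\<And>(z::complex) r l m. norm z = 1 \<Longrightarrow> 0 \<le> r \<Longrightarrow> r\<^sup>2 \<le> 1 / 2 \<Longrightarrow> \<bar>l\<bar> \<le> 1 \<Longrightarrow> 2 \<le> m \<Longrightarrow>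
     \<bar>exp (l * ln (norm (\<Sum>j\<le>m. (z * of_real r) ^ j))) - 1 - l\<^sup>2 * r\<^sup>2 / 4
       - l * r * Re z - (l / 2 + l\<^sup>2 / 4) * r\<^sup>2 * Re (z ^ 2)\<bar> \<le> C * \<bar>l\<bar> * r ^ 3"
    using exp_ln_norm_truncated_geometric_approx by metis
  have "\<bar>expectation (\<lambda>\<omega>. exp (l * log_factor s m p \<omega>)) - 1 - l\<^sup>2 * real p powr (-1 - 2 * s) / 4\<bar>
       \<le> C * \<bar>l\<bar> * (real p powr (-1/2 - s)) ^ 3"
    if p: "prime p" and s: "s \<ge> 0" and m: "2 \<le> m" and l: "\<bar>l\<bar> \<le> 1" for p s m l
  proof -
    define r where "r = real p powr (-1/2 - s)"
    have r: "0 \<le> r" "r\<^sup>2 \<le> 1 / 2" "r\<^sup>2 = real p powr (-1 - 2 * s)"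
      using prime_powr_bounds[OF p s] by (auto simp: r_def)
    have int: "integrable M (\<lambda>\<omega>. z p \<omega> ^ k)" for k
      by (rule integrable_const_bound[of _ 1])
         (use measurable_z[OF p] norm_z[OF p] in \<open>auto simp: norm_power\<close>)
    have Re: "expectation (\<lambda>\<omega>. Re (z p \<omega> ^ k)) = 0" if "k > 0" for k
      using moment_z[OF p that] int[of k] by simp
    note intRe = int[THEN integrable_Re]
    define g where "g \<omega> = exp (l * log_factor s m p \<omega>) - 1 - l\<^sup>2 * r\<^sup>2 / 4
       - l * r * Re (z p \<omega> ^ 1) - (l / 2 + l\<^sup>2 / 4) * r\<^sup>2 * Re (z p \<omega> ^ 2)" for \<omega>
    have g: "integrable M g" "expectation g = expectation (\<lambda>\<omega>. exp (l * log_factor s m p \<omega>)) - 1 - l\<^sup>2 * r\<^sup>2 / 4"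
      unfolding g_def [abs_def] using integrable_exp_log_factor[OF p s m, of l] intRe[of 1] intRe[of 2] Re[of 1] Re[of 2]
      by (auto simp: prob_space)
    have gb: "\<bar>g \<omega>\<bar> \<le> C * \<bar>l\<bar> * r ^ 3" for \<omega>
      using bound[OF norm_z[OF p] r(1,2) l m, of \<omega>] by (simp add: g_def log_factor_def r_def)
    have "\<bar>expectation g\<bar> \<le> expectation (\<lambda>\<omega>. \<bar>g \<omega>\<bar>)" by (rule integral_abs_bound)
    also have "\<dots> \<le> C * \<bar>l\<bar> * r ^ 3"
      using gb g by (intro integral_le_const) auto
    finally show ?thesis unfolding g(2) using r by (simp add: r_def)
  qed
  with C show ?thesis by blast
qed

text \<open>The logarithm of a partial product behaves like a centred Gaussian whose variance is
  half of the displayed sum, with an error uniform in \<open>B\<close>, \<open>s\<close> and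
  \<open>m\<close>. The error is linear in \<open>l\<close>, hence bounded at the small parameters
  used later. The lower bound is restricted to small \<open>l\<close> because
  \<open>ln (1 + x) \<ge> x - 2 * x\<^sup>2\<close> is applied with
  \<open>\<bar>x\<bar> \<le> 1 / 2\<close>.\<close>

definition mgf_error :: "real \<Rightarrow> bool" where
  "mgf_error C \<longleftrightarrow> (\<forall>B s m l. finite B \<longrightarrow> B \<subseteq> {p. prime p} \<longrightarrow> s \<ge> 0 \<longrightarrow> 2 \<le> m \<longrightarrow> \<bar>l\<bar> \<le> 1 \<longrightarrow>
     expectation (\<lambda>\<omega>. exp (l * log_product s m B \<omega>))
       \<le> exp (l\<^sup>2 * (\<Sum>p\<in>B. real p powr (-1 - 2 * s)) / 4 + C * \<bar>l\<bar>) \<and>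
     (C * \<bar>l\<bar> \<le> 1 \<longrightarrow>
       exp (l\<^sup>2 * (\<Sum>p\<in>B. real p powr (-1 - 2 * s)) / 4 - C * \<bar>l\<bar>)
       \<le> expectation (\<lambda>\<omega>. exp (l * log_product s m B \<omega>))))"

lemma mgf_upper:
  assumes "mgf_error C" "finite B" "B \<subseteq> {p. prime p}" "s \<ge> 0" "2 \<le> m" "\<bar>l\<bar> \<le> 1"
  shows "expectation (\<lambda>\<omega>. exp (l * log_product s m B \<omega>))
    \<le> exp (l\<^sup>2 * (\<Sum>p\<in>B. real p powr (-1 - 2 * s)) / 4 + C * \<bar>l\<bar>)"
  using assms unfolding mgf_error_def by simp

lemma mgf_lower:
  assumes "mgf_error C" "finite B" "B \<subseteq> {p. prime p}" "s \<ge> 0" "2 \<le> m" "\<bar>l\<bar> \<le> 1" "C * \<bar>l\<bar> \<le> 1"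
  shows "exp (l\<^sup>2 * (\<Sum>p\<in>B. real p powr (-1 - 2 * s)) / 4 - C * \<bar>l\<bar>)
    \<le> expectation (\<lambda>\<omega>. exp (l * log_product s m B \<omega>))"
  using assms unfolding mgf_error_def by simp

lemma mgf_error_exists: "\<exists>C>0. mgf_error C"
proof -
  obtain C0 :: real where C0: "C0 > 0" and mgf:
    "\<And>p s m l. prime p \<Longrightarrow> s \<ge> 0 \<Longrightarrow> 2 \<le> m \<Longrightarrow> \<bar>l\<bar> \<le> 1 \<Longrightarrow>
     \<bar>expectation (\<lambda>\<omega>. exp (l * log_factor s m p \<omega>)) - 1 - l\<^sup>2 * real p powr (-1 - 2 * s) / 4\<bar>
       \<le> C0 * \<bar>l\<bar> * (real p powr (-1/2 - s)) ^ 3"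
    using mgf_log_factor by blast
  \<comment> \<open>In the lower bound one \<open>C0\<close> is the error of the expansion, and
    twice the bound \<open>d = 1 / 4 + C0\<close> for the quadratic term of the logarithm adds
    \<open>2 * C0 + 1 / 2\<close>. The factor 3 in \<open>C\<close> bounds the sum of
    \<open>p powr (-3/2)\<close>.\<close>
  define C1 where "C1 = 3 * C0 + 1 / 2"
  define C where "C = 3 * C1"
  have C: "C1 > 0" "C > 0" using C0 by (auto simp: C_def C1_def)
  have "expectation (\<lambda>\<omega>. exp (l * log_product s m B \<omega>))
       \<le> exp (l\<^sup>2 * (\<Sum>p\<in>B. real p powr (-1 - 2 * s)) / 4 + C * \<bar>l\<bar>) \<and>
     (C * \<bar>l\<bar> \<le> 1 \<longrightarrow>
       exp (l\<^sup>2 * (\<Sum>p\<in>B. real p powr (-1 - 2 * s)) / 4 - C * \<bar>l\<bar>)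
       \<le> expectation (\<lambda>\<omega>. exp (l * log_product s m B \<omega>)))"
    if B: "finite B" "B \<subseteq> {p. prime p}" and s: "s \<ge> 0" and m: "2 \<le> m" and l: "\<bar>l\<bar> \<le> 1" for B s m l
  proof -
    define q where "q p = l\<^sup>2 * real p powr (-1 - 2 * s) / 4" for p :: nat
    define e where "e p = C1 * \<bar>l\<bar> * (real p powr (-1/2 - s)) ^ 3" for p :: nat
    define E where "E p = expectation (\<lambda>\<omega>. exp (l * log_factor s m p \<omega>))" for p
    have prod: "expectation (\<lambda>\<omega>. exp (l * log_product s m B \<omega>)) = (\<Prod>p\<in>B. E p)"
      unfolding E_def using B s m by (intro expectation_exp_log_product) auto
    have E0: "E p \<ge> 0" for p unfolding E_def by (intro Bochner_Integration.integral_nonneg) simp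
    have up: "E p \<le> exp (q p + e p)" if "p \<in> B" for p
    proof -
      have "E p \<le> 1 + (q p + C0 * \<bar>l\<bar> * (real p powr (-1/2 - s)) ^ 3)"
        using mgf[of p s m l] that B s m l unfolding E_def q_def by auto
      also have "C0 * \<bar>l\<bar> * (real p powr (-1/2 - s)) ^ 3 \<le> e p"
        unfolding e_def using C0 by (intro mult_right_mono) (auto simp: C1_def)
      also have "1 + (q p + e p) \<le> exp (q p + e p)" by (rule exp_ge_add_one_self)
      finally show ?thesis by simp
    qed
    have low: "exp (q p - e p) \<le> E p" if "p \<in> B" and Cl: "C * \<bar>l\<bar> \<le> 1" for p
    proof -
      define r where "r = real p powr (-1/2 - s)"
      have p: "prime p" using that B by auto
      have r: "0 \<le> r" "r \<le> 1" "r\<^sup>2 \<le> 1 / 2" "r\<^sup>2 = real p powr (-1 - 2 * s)"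
        using prime_powr_bounds[OF p s] by (auto simp: r_def)
      define d where "d = 1 / 4 + C0"
      have dl: "d * \<bar>l\<bar> \<le> 1" "0 \<le> d * \<bar>l\<bar>"
        using Cl C0 mult_right_mono[of d C "\<bar>l\<bar>"] by (auto simp: d_def C_def C1_def)
      define x where "x = q p - C0 * \<bar>l\<bar> * r ^ 3"
      have "\<bar>x\<bar> \<le> q p + C0 * \<bar>l\<bar> * r ^ 3"
        unfolding x_def q_def using C0 r by (intro abs_leI) (auto simp: q_def)
      also have "q p \<le> \<bar>l\<bar> * r\<^sup>2 / 4"
        unfolding q_def r(4) [symmetric] using l power_decreasing[of 1 2 "\<bar>l\<bar>"]
        by (intro divide_right_mono mult_right_mono) auto
      also have "C0 * \<bar>l\<bar> * r ^ 3 \<le> C0 * \<bar>l\<bar> * r\<^sup>2"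
        using C0 r by (intro mult_left_mono power_decreasing) auto
      finally have x: "\<bar>x\<bar> \<le> d * \<bar>l\<bar> * r\<^sup>2" by (simp add: d_def algebra_simps)
      also have "\<dots> \<le> 1 * (1 / 2)" using dl r by (intro mult_mono) auto
      finally have x2: "\<bar>x\<bar> \<le> 1 / 2" by simp
      have "x\<^sup>2 = \<bar>x\<bar> * \<bar>x\<bar>" by (simp add: power2_eq_square)
      also have "\<dots> \<le> (d * \<bar>l\<bar> * r\<^sup>2) * (1 * r\<^sup>2)"
        using x dl mult_right_mono[of "d * \<bar>l\<bar>" 1 "r\<^sup>2"] by (intro mult_mono) auto
      also have "\<dots> = d * \<bar>l\<bar> * r ^ 4" by (simp add: eval_nat_numeral)
      also have "\<dots> \<le> d * \<bar>l\<bar> * r ^ 3" using dl r by (intro mult_left_mono power_decreasing) auto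
      finally have xsq: "x\<^sup>2 \<le> d * \<bar>l\<bar> * r ^ 3" .
      have "q p - e p = x - 2 * (d * \<bar>l\<bar> * r ^ 3)"
        by (simp add: x_def e_def C1_def d_def r_def algebra_simps)
      also have "\<dots> \<le> x - 2 * x\<^sup>2" using xsq by simp
      also have "\<dots> \<le> ln (1 + x)"
        using abs_ln_one_plus_x_minus_x_bound[of x] x2 by linarith
      finally have "exp (q p - e p) \<le> 1 + x"
        using x2 by (subst ln_ge_iff [symmetric]) auto
      also have "\<dots> \<le> E p"
        using mgf[OF p s m l] unfolding E_def x_def q_def r_def by linarith
      finally show ?thesis .
    qed
    have sumq: "(\<Sum>p\<in>B. q p) = l\<^sup>2 * (\<Sum>p\<in>B. real p powr (-1 - 2 * s)) / 4"
      by (simp add: q_def sum_distrib_left sum_divide_distrib)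
    have "(\<Sum>p\<in>B. (real p powr (-1/2 - s)) ^ 3) \<le> (\<Sum>p\<in>B. real p powr (-1 - 1/2))"
      using B s prime_powr_bounds(4) by (intro sum_mono) auto
    also have "\<dots> \<le> 1 + 1 / (1 / 2)"
      using B by (intro sum_powr_upper) auto
    finally have "C1 * \<bar>l\<bar> * (\<Sum>p\<in>B. (real p powr (-1/2 - s)) ^ 3) \<le> C1 * \<bar>l\<bar> * 3"
      using C by (intro mult_left_mono) auto
    then have sume: "(\<Sum>p\<in>B. e p) \<le> C * \<bar>l\<bar>"
      by (simp add: e_def C_def sum_distrib_left [symmetric] mult_ac)
    have "(\<Prod>p\<in>B. E p) \<le> (\<Prod>p\<in>B. exp (q p + e p))"
      using up E0 by (intro prod_mono) auto
    also have "\<dots> = exp ((\<Sum>p\<in>B. q p) + (\<Sum>p\<in>B. e p))"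
      using B by (simp add: exp_sum [symmetric] sum.distrib)
    finally have 1: "(\<Prod>p\<in>B. E p) \<le> exp ((\<Sum>p\<in>B. q p) + C * \<bar>l\<bar>)"
      using sume by (meson add_left_mono exp_le_cancel_iff order_trans)
    have 2: "exp ((\<Sum>p\<in>B. q p) - C * \<bar>l\<bar>) \<le> (\<Prod>p\<in>B. E p)" if "C * \<bar>l\<bar> \<le> 1"
    proof -
      have "exp ((\<Sum>p\<in>B. q p) - C * \<bar>l\<bar>) \<le> exp ((\<Sum>p\<in>B. q p) - (\<Sum>p\<in>B. e p))"
        using sume by simp
      also have "\<dots> = (\<Prod>p\<in>B. exp (q p - e p))"
        using B by (simp add: exp_sum [symmetric] sum_subtractf)
      also have "\<dots> \<le> (\<Prod>p\<in>B. E p)"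
        using low that by (intro prod_mono) auto
      finally show ?thesis .
    qed
    show ?thesis using 1 2 unfolding prod sumq by blast
  qed
  then have "mgf_error C" unfolding mgf_error_def by simp
  with C show ?thesis by blast
qed

end

section \<open>Dirichlet polynomials and Euler products\<close>

lemma borel_measurable_cnj [measurable]: "cnj \<in> borel_measurable borel"
  by (intro borel_measurable_continuous_onI continuous_on_cnj continuous_on_id)

context steinhaus_primes
begin

section \<open>Orthogonality of the values and comparison in mean square\<close>

lemma measurable_mult_ext_z: "random_variable borel (\<lambda>\<omega>. mult_ext (\<lambda>p. z p \<omega>) n)"
  unfolding mult_ext_def
  by (intro borel_measurable_prod borel_measurable_power measurable_z in_prime_factors_imp_prime)

lemma norm_mult_ext_z: "norm (mult_ext (\<lambda>p. z p \<omega>) n) = 1"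
  unfolding mult_ext_def prod_norm [symmetric] norm_power
  by (rule prod.neutral) (auto simp: norm_z in_prime_factors_imp_prime)

lemma moment_z_cnj:
  assumes "prime p" "a \<noteq> b"
  shows "expectation (\<lambda>\<omega>. z p \<omega> ^ a * cnj (z p \<omega>) ^ b) = 0"
proof -
  have zc: "z p \<omega> * cnj (z p \<omega>) = 1" for \<omega>
    using complex_norm_square[of "z p \<omega>"] norm_z[OF assms(1), of \<omega>] by simp
  consider "a > b" | "b > a" using assms(2) by linarith
  then show ?thesis
  proof cases
    case 1
    have "z p \<omega> ^ a * cnj (z p \<omega>) ^ b = z p \<omega> ^ (a - b) * (z p \<omega> * cnj (z p \<omega>)) ^ b" for \<omega>
      using 1 by (simp add: power_mult_distrib mult.assoc [symmetric] power_add [symmetric])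
    then show ?thesis using 1 moment_z[OF assms(1), of "a - b"] by (simp add: zc)
  next
    case 2
    have "z p \<omega> ^ a * cnj (z p \<omega>) ^ b = cnj (z p \<omega> ^ (b - a)) * (z p \<omega> * cnj (z p \<omega>)) ^ a" for \<omega>
      using 2 by (simp add: power_mult_distrib mult.commute mult.left_commute power_add [symmetric])
    then show ?thesis using 2 moment_z[OF assms(1), of "b - a"] by (simp add: zc del: complex_cnj_power)
  qed
qed

lemma smooth_numbers_eqI:
  assumes "n \<in> smooth_numbers N" "m \<in> smooth_numbers N"
    and "\<And>p. p \<in> primes_upto N \<Longrightarrow> multiplicity p n = multiplicity p m"
  shows "n = m"
proof -
  have id: "k = mult_ext (\<lambda>p. p) k" if "k \<in> smooth_numbers N" for k
    using smooth_numbers_pos[OF that] prime_factorization_nat[of k] by (simp add: mult_ext_def)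
  show ?thesis
    using assms id[OF assms(1)] id[OF assms(2)] by (simp add: mult_ext_smooth)
qed

text \<open>Independence factorises the expectation over the primes up to \<open>N\<close>; distinct
  numbers differ in the exponent of one such prime, and that factor has mean zero.\<close>

lemma mult_ext_z_orthogonal:
  assumes n: "n \<in> smooth_numbers N" and m: "m \<in> smooth_numbers N" and "n \<noteq> m"
  shows "expectation (\<lambda>\<omega>. mult_ext (\<lambda>p. z p \<omega>) n * cnj (mult_ext (\<lambda>p. z p \<omega>) m)) = 0"
proof -
  define X where "X p \<omega> = z p \<omega> ^ multiplicity p n * cnj (z p \<omega>) ^ multiplicity p m" for p \<omega>
  have "mult_ext (\<lambda>p. z p \<omega>) n * cnj (mult_ext (\<lambda>p. z p \<omega>) m) = (\<Prod>p\<in>primes_upto N. X p \<omega>)" for \<omega>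
    by (simp add: mult_ext_smooth[OF n] mult_ext_smooth[OF m] X_def prod.distrib)
  moreover have "expectation (\<lambda>\<omega>. \<Prod>p\<in>primes_upto N. X p \<omega>) = (\<Prod>p\<in>primes_upto N. expectation (X p))"
  proof (rule indep_vars_lebesgue_integral)
    show "indep_vars (\<lambda>_. borel) X (primes_upto N)"
      unfolding X_def [abs_def]
      by (rule indep_vars_compose2[where X = z and M' = "\<lambda>_. borel" and Y = "\<lambda>p x. x ^ multiplicity p n * cnj x ^ multiplicity p m"])
         (use indep_vars_subset[OF indep, of "primes_upto N"] in \<open>auto simp: primes_upto_def\<close>)
    fix p assume "p \<in> primes_upto N"
    then have p: "prime p" by (simp add: primes_upto_def)
    show "integrable M (X p)"
      unfolding X_def [abs_def]
      by (rule integrable_const_bound[of _ 1])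
         (use norm_z[OF p] measurable_compose[OF measurable_z[OF p], of "\<lambda>x. x ^ multiplicity p n * cnj x ^ multiplicity p m" borel]
           in \<open>auto simp: norm_mult norm_power\<close>)
  qed auto
  moreover obtain p where p: "p \<in> primes_upto N" "multiplicity p n \<noteq> multiplicity p m"
    using smooth_numbers_eqI[OF n m] \<open>n \<noteq> m\<close> by blast
  then have "expectation (X p) = 0"
    unfolding X_def [abs_def] by (intro moment_z_cnj) (auto simp: primes_upto_def)
  then have "(\<Prod>p\<in>primes_upto N. expectation (X p)) = 0"
    using p by (intro prod_zero) auto
  ultimately show ?thesis by simp
qed

lemma expectation_norm_square:
  fixes c :: "nat \<Rightarrow> real"
  assumes "T \<subseteq> smooth_numbers N"
  shows "expectation (\<lambda>\<omega>. (norm (\<Sum>n\<in>T. of_real (c n) * mult_ext (\<lambda>p. z p \<omega>) n))\<^sup>2) = (\<Sum>n\<in>T. (c n)\<^sup>2)"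
proof -
  have fin: "finite T" by (rule finite_subset[OF assms]) simp
  define Z where "Z n \<omega> = mult_ext (\<lambda>p. z p \<omega>) n" for n \<omega>
  have [measurable]: "random_variable borel (Z n)" for n
    unfolding Z_def [abs_def] by (rule measurable_mult_ext_z)
  have ZZ: "expectation (\<lambda>\<omega>. Z n \<omega> * cnj (Z m \<omega>)) = (if n = m then 1 else 0)" if "n \<in> T" "m \<in> T" for n m
  proof (cases "n = m")
    case True
    have "Z m \<omega> * cnj (Z m \<omega>) = 1" for \<omega>
      using complex_norm_square[of "Z m \<omega>"] norm_mult_ext_z[of \<omega> m] by (simp add: Z_def)
    then show ?thesis using True by (simp add: prob_space)
  next
    case False
    then show ?thesis using mult_ext_z_orthogonal[of n N m] that assms by (auto simp: Z_def)
  qed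
  have int: "integrable M (\<lambda>\<omega>. Z n \<omega> * cnj (Z m \<omega>))" for n m
  proof (rule integrable_const_bound[of _ 1])
    show "AE \<omega> in M. norm (Z n \<omega> * cnj (Z m \<omega>)) \<le> 1" by (simp add: Z_def norm_mult norm_mult_ext_z)
  qed measurable
  have sq: "complex_of_real ((norm (\<Sum>n\<in>T. of_real (c n) * Z n \<omega>))\<^sup>2)
      = (\<Sum>n\<in>T. \<Sum>m\<in>T. of_real (c n * c m) * (Z n \<omega> * cnj (Z m \<omega>)))" for \<omega>
    unfolding complex_norm_square cnj_sum sum_product by (intro sum.cong refl) (simp add: mult_ac)
  have "complex_of_real (expectation (\<lambda>\<omega>. (norm (\<Sum>n\<in>T. of_real (c n) * Z n \<omega>))\<^sup>2))
      = expectation (\<lambda>\<omega>. \<Sum>n\<in>T. \<Sum>m\<in>T. of_real (c n * c m) * (Z n \<omega> * cnj (Z m \<omega>)))"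
    unfolding integral_complex_of_real [symmetric] sq ..
  also have "\<dots> = (\<Sum>n\<in>T. \<Sum>m\<in>T. of_real (c n * c m) * expectation (\<lambda>\<omega>. Z n \<omega> * cnj (Z m \<omega>)))"
    using int by (simp add: integral_sum)
  also have "\<dots> = (\<Sum>n\<in>T. \<Sum>m\<in>T. if n = m then of_real (c n * c m) else 0)"
    by (intro sum.cong refl) (simp add: ZZ)
  also have "\<dots> = complex_of_real (\<Sum>n\<in>T. (c n)\<^sup>2)"
    using fin by (simp add: power2_eq_square)
  finally show ?thesis unfolding Z_def of_real_eq_iff .
qed

definition dirichlet_poly :: "real \<Rightarrow> nat \<Rightarrow> 'a \<Rightarrow> complex" where
  "dirichlet_poly s N \<omega> = (\<Sum>n\<in>{1..N}. of_real (real n powr (-1/2 - s)) * mult_ext (\<lambda>p. z p \<omega>) n)"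

definition euler_product :: "real \<Rightarrow> nat \<Rightarrow> 'a \<Rightarrow> complex" where
  "euler_product s N \<omega> = (\<Prod>p\<in>primes_upto N. \<Sum>j\<le>N. (z p \<omega> * of_real (real p powr (-1/2 - s))) ^ j)"

lemma norm_euler_product:
  assumes "s \<ge> 0" "N \<ge> 2"
  shows "norm (euler_product s N \<omega>) = exp (log_product s N (primes_upto N) \<omega>)"
proof -
  have "norm (\<Sum>j\<le>N. (z p \<omega> * of_real (real p powr (-1/2 - s))) ^ j) = exp (log_factor s N p \<omega>)"
    if "p \<in> primes_upto N" for p
  proof -
    have p: "prime p" using that by (simp add: primes_upto_def)
    \<comment> \<open>Nonvanishing matters here: with the convention \<open>ln 0 = 0\<close> a zero
      factor would be turned into 1 by \<open>exp\<close>.\<close>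
    have "(\<Sum>j\<le>N. (z p \<omega> * of_real (real p powr (-1/2 - s))) ^ j) \<noteq> 0"
      using assms prime_powr_bounds(2)[OF p assms(1)]
      by (intro ln_norm_truncated_geometric_approx(1)) (auto simp: norm_mult norm_z[OF p])
    then show ?thesis by (simp add: log_factor_def)
  qed
  then show ?thesis
    by (simp add: euler_product_def log_product_def prod_norm [symmetric] exp_sum)
qed

lemma euler_product_minus_dirichlet_poly:
  "euler_product s N \<omega> - dirichlet_poly s N \<omega> =
     (\<Sum>n\<in>smooth_numbers N - {1..N}. of_real (real n powr (-1/2 - s)) * mult_ext (\<lambda>p. z p \<omega>) n)"
proof -
  have "euler_product s N \<omega> = (\<Sum>n\<in>smooth_numbers N. of_real (real n powr (-1/2 - s)) * mult_ext (\<lambda>p. z p \<omega>) n)"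
    unfolding euler_product_def truncated_euler_product
  proof (rule sum.cong[OF refl])
    fix n assume "n \<in> smooth_numbers N"
    then show "mult_ext (\<lambda>p. z p \<omega> * of_real (real p powr (-1/2 - s))) n
        = of_real (real n powr (-1/2 - s)) * mult_ext (\<lambda>p. z p \<omega>) n"
      using mult_ext_powr[of n "-1/2 - s"] smooth_numbers_pos
      by (simp add: mult_ext_mult mult_ext_of_real)
  qed
  then show ?thesis
    unfolding dirichlet_poly_def
    by (subst sum_diff[OF _ atLeastAtMost_subset_smooth_numbers]) auto
qed

text \<open>Markov's inequality for the squared modulus: by orthogonality the second moment of the
  difference is the sum of \<open>n powr (-1 - 2 * s)\<close> over smooth
  \<open>n > N\<close>.\<close>

lemma prob_euler_product_far_from_dirichlet_poly:
  assumes s: "s > 0" and N: "N > 0"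
  shows "prob {\<omega> \<in> space M. 1 \<le> norm (euler_product s N \<omega> - dirichlet_poly s N \<omega>)}
    \<le> real N powr (-2 * s) / (2 * s)"
proof -
  define T where "T = smooth_numbers N - {1..N}"
  define D where "D \<omega> = (\<Sum>n\<in>T. of_real (real n powr (-1/2 - s)) * mult_ext (\<lambda>p. z p \<omega>) n)" for \<omega>
  have [measurable]: "random_variable borel D"
    unfolding D_def [abs_def] using measurable_mult_ext_z by measurable
  have bound: "norm (D \<omega>) \<le> (\<Sum>n\<in>T. real n powr (-1/2 - s))" for \<omega>
    unfolding D_def by (rule sum_norm_le) (simp add: norm_mult norm_mult_ext_z)
  have "prob {\<omega> \<in> space M. 1 \<le> (norm (D \<omega>))\<^sup>2} \<le> expectation (\<lambda>\<omega>. (norm (D \<omega>))\<^sup>2) / 1"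
  proof (rule integral_Markov_inequality_measure[where A = "{}"])
    show "integrable M (\<lambda>\<omega>. (norm (D \<omega>))\<^sup>2)"
      by (rule integrable_const_bound[of _ "(\<Sum>n\<in>T. real n powr (-1/2 - s))\<^sup>2"])
         (use power_mono[OF bound] in auto)
  qed auto
  also have "\<dots> = (\<Sum>n\<in>T. (real n powr (-1/2 - s))\<^sup>2)"
    unfolding D_def by (subst expectation_norm_square[of _ N]) (auto simp: T_def)
  also have "\<dots> = (\<Sum>n\<in>T. real n powr (-1 - 2 * s))"
    by (intro sum.cong refl) (simp add: power2_eq_square powr_add [symmetric])
  also have "\<dots> \<le> real N powr (- (2 * s)) / (2 * s)"
  proof (rule sum_powr_tail)
    fix n assume "n \<in> T"
    then show "N < n" using smooth_numbers_pos[of n N] by (auto simp: T_def)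
  qed (use s N in \<open>auto simp: T_def\<close>)
  finally show ?thesis
    unfolding euler_product_minus_dirichlet_poly T_def [symmetric] D_def [symmetric]
    by (simp add: abs_square_less_1 linorder_not_less [symmetric])
qed

end

section \<open>Summation by parts and the choice of scales\<close>

lemma summation_by_parts_partial_sums:
  fixes a w :: "nat \<Rightarrow> 'b::comm_ring"
  shows "(\<Sum>n\<in>{1..N}. w n * a n) =
    w N * (\<Sum>j\<in>{1..N}. a j) + (\<Sum>n\<in>{1..<N}. (w n - w (Suc n)) * (\<Sum>j\<in>{1..n}. a j))"
proof (induction N)
  case (Suc N)
  show ?case
  proof (cases "N = 0")
    case False
    then have "(\<Sum>n\<in>{1..<Suc N}. (w n - w (Suc n)) * (\<Sum>j\<in>{1..n}. a j)) =
        (\<Sum>n\<in>{1..<N}. (w n - w (Suc n)) * (\<Sum>j\<in>{1..n}. a j)) + (w N - w (Suc N)) * (\<Sum>j\<in>{1..N}. a j)"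
      by (subst sum.atLeastLessThan_Suc) auto
    then show ?thesis using Suc.IH by (simp add: algebra_simps)
  qed auto
qed auto

text \<open>The majorant \<open>A + D * ln n\<close> is itself a sequence of partial sums. Since the
  weights decrease, summation by parts in one direction bounds the given sum, and in the other
  direction it evaluates the bound. It is applied with \<open>D = s\<close>, where
  \<open>D * (1 + 1 / s) = s + 1\<close> stays bounded.\<close>

lemma norm_sum_powr_le:
  fixes a :: "nat \<Rightarrow> complex"
  assumes s: "s > 0" and D: "D \<ge> 0" and A: "A \<ge> 0"
    and S: "\<And>n. n \<in> {1..N} \<Longrightarrow> norm (\<Sum>j\<in>{1..n}. a j) \<le> A + D * ln (real n)"
  shows "norm (\<Sum>n\<in>{1..N}. of_real (real n powr (-s)) * a n) \<le> A + D * (1 + 1 / s)"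
proof (cases "N = 0")
  case False
  define w where "w n = real n powr (-s)" for n :: nat
  \<comment> \<open>Chosen so that its partial sums are exactly \<open>A + D * ln n\<close>; the
    first term is \<open>A\<close> because \<open>ln 1 = 0\<close>.\<close>
  define b where "b n = (if n = 1 then A else D * (ln (real n) - ln (real (n - 1))))" for n :: nat
  have B: "(\<Sum>j\<in>{1..n}. b j) = A + D * ln (real n)" if "n \<ge> 1" for n
    using that by (induction n rule: nat_induct_at_least) (auto simp: b_def algebra_simps)
  have w: "w n \<ge> w (Suc n)" if "n \<ge> 1" for n
    unfolding w_def using that s by (intro powr_mono2') auto
  have "norm (\<Sum>n\<in>{1..N}. of_real (w n) * a n) = norm (of_real (w N) * (\<Sum>j\<in>{1..N}. a j)
      + (\<Sum>n\<in>{1..<N}. (of_real (w n) - of_real (w (Suc n))) * (\<Sum>j\<in>{1..n}. a j)))"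
    by (subst summation_by_parts_partial_sums[of "\<lambda>n. of_real (w n)"]) simp
  also have "\<dots> \<le> norm (of_real (w N) * (\<Sum>j\<in>{1..N}. a j))
      + (\<Sum>n\<in>{1..<N}. norm ((of_real (w n) - of_real (w (Suc n))) * (\<Sum>j\<in>{1..n}. a j)))"
    by (rule order_trans[OF norm_triangle_ineq add_left_mono[OF norm_sum]])
  also have "\<dots> \<le> w N * (A + D * ln (real N)) + (\<Sum>n\<in>{1..<N}. (w n - w (Suc n)) * (A + D * ln (real n)))"
  proof (intro add_mono sum_mono)
    show "norm (of_real (w N) * (\<Sum>j\<in>{1..N}. a j)) \<le> w N * (A + D * ln (real N))"
      using S[of N] False by (simp add: norm_mult w_def mult_left_mono)
    fix n assume n: "n \<in> {1..<N}"
    have "norm ((of_real (w n) - of_real (w (Suc n))) * (\<Sum>j\<in>{1..n}. a j))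
       = (w n - w (Suc n)) * norm (\<Sum>j\<in>{1..n}. a j)"
      using w[of n] n by (simp add: norm_mult flip: of_real_diff)
    also have "\<dots> \<le> (w n - w (Suc n)) * (A + D * ln (real n))"
      using w[of n] n S[of n] by (intro mult_left_mono) auto
    finally show "norm ((of_real (w n) - of_real (w (Suc n))) * (\<Sum>j\<in>{1..n}. a j))
      \<le> (w n - w (Suc n)) * (A + D * ln (real n))" .
  qed
  also have "\<dots> = (\<Sum>n\<in>{1..N}. w n * b n)"
    using False by (simp add: summation_by_parts_partial_sums[of w b] B del: One_nat_def)
  also have "\<dots> = A + (\<Sum>n\<in>{1..<N}. w (Suc n) * (D * (ln (real (Suc n)) - ln (real n))))"
  proof -
    have "{1..N} = insert 1 (Suc ` {1..<N})"
    proof (intro equalityI subsetI)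
      fix n assume n: "n \<in> {1..N}"
      show "n \<in> insert 1 (Suc ` {1..<N})"
      proof (cases "n = 1")
        case False
        then have "n = Suc (n - 1)" "n - 1 \<in> {1..<N}" using n by auto
        then show ?thesis by blast
      qed auto
    qed (use False in auto)
    then have "(\<Sum>n\<in>{1..N}. w n * b n) = w 1 * b 1 + (\<Sum>n\<in>Suc ` {1..<N}. w n * b n)"
      by (simp add: image_iff)
    also have "(\<Sum>n\<in>Suc ` {1..<N}. w n * b n) = (\<Sum>n\<in>{1..<N}. w (Suc n) * b (Suc n))"
      by (subst sum.reindex) auto
    finally show ?thesis by (simp add: b_def w_def)
  qed
  also have "\<dots> \<le> A + (\<Sum>n\<in>{1..<N}. D * real n powr (-1 - s))"
  proof (intro add_left_mono sum_mono)
    fix n assume n: "n \<in> {1..<N}"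
    have "ln (real (Suc n)) - ln (real n) = ln (1 + 1 / real n)"
      using n ln_div[of "real (Suc n)" "real n"] by (simp add: field_simps)
    also have "\<dots> \<le> 1 / real n" using n by (intro ln_add_one_self_le_self) auto
    finally have "w (Suc n) * (D * (ln (real (Suc n)) - ln (real n))) \<le> w n * (D * (1 / real n))"
      using w[of n] n D by (intro mult_mono mult_left_mono mult_nonneg_nonneg) (auto simp: w_def)
    also have "\<dots> = D * real n powr (-1 - s)"
      using n by (simp add: w_def powr_diff powr_minus field_simps)
    finally show "w (Suc n) * (D * (ln (real (Suc n)) - ln (real n))) \<le> D * real n powr (-1 - s)" .
  qed
  also have "(\<Sum>n\<in>{1..<N}. D * real n powr (-1 - s)) \<le> D * (1 + 1 / s)"
    unfolding sum_distrib_left [symmetric] using s D by (intro mult_left_mono sum_powr_upper) auto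
  finally show ?thesis by (simp add: w_def)
qed (use assms in auto)

text \<open>
  The factorials make the levels grow fast enough for the old primes to be negligible at the
  next stage, and slowly enough to keep \<open>ln (ln (level k))\<close> asymptotic to \<open>ln k\<close>, as needed for
  the divergence of the probabilities in the second Borel--Cantelli lemma.
\<close>

definition level :: "nat \<Rightarrow> real" where "level k = (fact k)\<^sup>2"

definition offset :: "nat \<Rightarrow> real" where "offset k = exp (- level k)"

definition cutoff :: "nat \<Rightarrow> nat" where "cutoff k = nat \<lceil>exp (exp (2 * level k))\<rceil>"

lemma level_ge: "level k \<ge> 1" "level k \<ge> real k" "level k \<le> level (Suc k)"
  "level (Suc k) = (real k + 1)\<^sup>2 * level k"
proof -
  have "(1::real) \<le> fact k" by (rule fact_ge_1)
  then show 1: "level k \<ge> 1" unfolding level_def by (rule one_le_power)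
  have "real k \<le> fact k" using fact_ge_self[of k] by (metis of_nat_fact of_nat_le_iff)
  also have "fact k \<le> level k"
    unfolding level_def power2_eq_square by (metis \<open>1 \<le> fact k\<close> mult_le_cancel_left1 fact_ge_zero less_le_not_le)
  finally show "level k \<ge> real k" .
  show 2: "level (Suc k) = (real k + 1)\<^sup>2 * level k"
    by (simp add: level_def power_mult_distrib add.commute)
  show "level k \<le> level (Suc k)"
    unfolding 2 using 1 by (simp add: mult_le_cancel_right1)
qed

lemma offset_pos: "offset k > 0"
  by (simp add: offset_def)

lemma cutoff_bounds: "exp (exp (2 * level k)) \<le> real (cutoff k)"
  "real (cutoff k) \<le> exp (exp (2 * level k)) + 1" "3 \<le> cutoff k" "cutoff k \<le> cutoff (Suc k)"
proof -
  show 1: "exp (exp (2 * level k)) \<le> real (cutoff k)" by (simp add: cutoff_def)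
  show "real (cutoff k) \<le> exp (exp (2 * level k)) + 1"
    unfolding cutoff_def using of_int_ceiling_le_add_one[of "exp (exp (2 * level k))"]
    by (subst of_nat_nat) (simp_all add: less_trans[OF _ exp_gt_zero])
  have "3 \<le> exp (exp (2 * level k))"
    using exp_ge_add_one_self[of "2 * level k"] exp_ge_add_one_self[of "exp (2 * level k)"] level_ge(1)[of k]
    by linarith
  with 1 show "3 \<le> cutoff k" by linarith
  show "cutoff k \<le> cutoff (Suc k)"
    unfolding cutoff_def using level_ge(3)[of k] by (intro nat_mono ceiling_mono) auto
qed

lemma cutoff_powr: "real (cutoff k) powr (-2 * offset k) \<le> exp (- 2 * exp (level k))"
proof -
  have "real (cutoff k) powr (-2 * offset k) \<le> exp (exp (2 * level k)) powr (-2 * offset k)"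
    using cutoff_bounds(1) offset_pos[of k] by (intro powr_mono2') auto
  also have "\<dots> = exp (- 2 * (exp (2 * level k) * offset k))"
    by (simp add: powr_def)
  also have "exp (2 * level k) * offset k = exp (level k)"
    by (simp add: offset_def exp_add [symmetric])
  finally show ?thesis .
qed

lemma cutoff_powr_le_half: "real (cutoff k) powr (-2 * offset k) \<le> 1 / 2"
proof -
  have "exp (level k) \<ge> 1" using level_ge(1)[of k] by simp
  then have "exp (- 2 * exp (level k)) \<le> exp (-1)" unfolding exp_le_cancel_iff by linarith
  also have "\<dots> \<le> 1 / (2 :: real)" using exp_ge_add_one_self[of "1::real"] by (simp add: exp_minus field_simps)
  finally show ?thesis using cutoff_powr[of k] by linarith
qed

text \<open>At this cutoff \<open>N powr (-2 * s)\<close> is at most \<open>exp (-2 / s)\<close>,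
  which absorbs the division by \<open>s\<close> and leaves a bound summable in \<open>k\<close>, as
  the first Borel--Cantelli lemma requires.\<close>

lemma cutoff_powr_tail: "real (cutoff k) powr (-2 * offset k) / (2 * offset k) \<le> exp (- real k)"
proof -
  have "real (cutoff k) powr (-2 * offset k) / (2 * offset k) \<le> exp (- 2 * exp (level k)) / (1 * offset k)"
    using cutoff_powr[of k] offset_pos[of k] by (intro frac_le) auto
  also have "\<dots> = exp (level k - 2 * exp (level k))" by (simp add: offset_def exp_diff exp_minus field_simps)
  also have "\<dots> \<le> exp (- real k)"
    unfolding exp_le_cancel_iff
    using exp_ge_add_one_self[of "level k"] level_ge(2)[of k] by linarith
  finally show ?thesis .
qed

lemma ln_le_of_le_exp: "0 < x \<Longrightarrow> x \<le> exp c \<Longrightarrow> ln x \<le> (c::real)"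
  by (metis ln_exp ln_mono)

lemma prime_sum_cutoff: "(\<Sum>p\<in>primes_upto (cutoff k). 1 / real p) \<le> 24 * level k"
proof -
  have pos: "exp (2 * level k) \<ge> 1" using level_ge(1)[of k] by simp
  have "real (cutoff k) \<le> exp (exp (2 * level k)) * 2"
    using cutoff_bounds(2)[of k] exp_ge_add_one_self[of "exp (2 * level k)"] pos by linarith
  also have "\<dots> \<le> exp (exp (2 * level k)) * exp 1"
    using exp_ge_add_one_self[of "1::real"] by (intro mult_left_mono) auto
  finally have "ln (real (cutoff k)) \<le> exp (2 * level k) + 1"
    using cutoff_bounds(3)[of k] by (intro ln_le_of_le_exp) (auto simp: exp_add)
  then have "1 + ln (real (cutoff k)) \<le> exp (2 * level k) * 3" using pos by linarith
  also have "\<dots> \<le> exp (2 * level k) * exp 2"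
    using exp_ge_add_one_self[of "2::real"] by (intro mult_left_mono) auto
  finally have "ln (1 + ln (real (cutoff k))) \<le> 2 * level k + 2"
    using cutoff_bounds(3)[of k] by (intro ln_le_of_le_exp) (auto simp: exp_add add_pos_nonneg)
  also have "\<dots> \<le> 4 * level k" using level_ge(1)[of k] by simp
  finally have "2 * exp 1 * ln (1 + ln (real (cutoff k))) \<le> 2 * 3 * (4 * level k)"
    using exp_le level_ge(1)[of k] cutoff_bounds(3)[of k] by (intro mult_mono) auto
  then show ?thesis using prime_sum_upper[OF cutoff_bounds(3)[of k]] by simp
qed

section \<open>The primes that are new at a stage, and their variance\<close>

definition new_primes :: "nat \<Rightarrow> nat set" where
  "new_primes k = primes_upto (cutoff (Suc k)) - primes_upto (cutoff k)"

text \<open>To leading order twice the variance of the logarithm of the new part of the product,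
  since \<open>Re z\<close> has variance \<open>1 / 2\<close>. For this reason \<open>W / 2\<close>
  appears below in the role of a variance.\<close>

definition new_variance :: "nat \<Rightarrow> real" where
  "new_variance k = (\<Sum>p\<in>new_primes k. real p powr (-1 - 2 * offset (Suc k)))"

lemma old_variance_le: "(\<Sum>p\<in>primes_upto (cutoff k). real p powr (-1 - 2 * offset (Suc k))) \<le> 24 * level k"
proof -
  have "(\<Sum>p\<in>primes_upto (cutoff k). real p powr (-1 - 2 * offset (Suc k))) \<le> (\<Sum>p\<in>primes_upto (cutoff k). 1 / real p)"
  proof (rule sum_mono)
    fix p assume "p \<in> primes_upto (cutoff k)"
    then have p: "real p \<ge> 1" using prime_gt_0_nat[of p] by (simp add: primes_upto_def)
    then have "real p powr (-1 - 2 * offset (Suc k)) \<le> real p powr (-1)"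
      using offset_pos[of "Suc k"] by (intro powr_mono) auto
    then show "real p powr (-1 - 2 * offset (Suc k)) \<le> 1 / real p"
      using p by (simp add: powr_minus divide_inverse)
  qed
  with prime_sum_cutoff[of k] show ?thesis by simp
qed

text \<open>The old primes take at most \<open>24 * level k\<close> from the full sum, and the
  constant 6 of \<open>prime_sum_lower\<close> is absorbed by \<open>level k \<ge> 1\<close>, whence
  30. Relative to \<open>level (Suc k)\<close> the loss is of order
  \<open>1 / k\<^sup>2\<close>.\<close>

lemma new_variance_ge: "level (Suc k) * (1 - 30 / (real k + 1)\<^sup>2) \<le> new_variance k"
proof -
  have sub: "primes_upto (cutoff k) \<subseteq> primes_upto (cutoff (Suc k))"
    using cutoff_bounds(4)[of k] by (auto simp: primes_upto_def)
  have "level (Suc k) - 6 \<le> (\<Sum>p\<in>primes_upto (cutoff (Suc k)). real p powr (-1 - 2 * offset (Suc k)))"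
    using prime_sum_lower[OF offset_pos _ cutoff_powr_le_half[of "Suc k"]] cutoff_bounds(3)[of "Suc k"]
    by (simp add: offset_def ln_div)
  also have "\<dots> = new_variance k + (\<Sum>p\<in>primes_upto (cutoff k). real p powr (-1 - 2 * offset (Suc k)))"
    unfolding new_variance_def new_primes_def by (rule sum.subset_diff[OF sub]) simp
  also have "\<dots> \<le> new_variance k + 24 * level k" using old_variance_le[of k] by simp
  finally have "level (Suc k) - 30 * level k \<le> new_variance k" using level_ge(1)[of k] by simp
  moreover have "level k = level (Suc k) / (real k + 1)\<^sup>2" unfolding level_ge(4) by simp
  ultimately show ?thesis by (simp add: right_diff_distrib)
qed

section \<open>Almost sure behaviour along the scales\<close>

context steinhaus_primes
begin

lemma eventually_euler_product_near_dirichlet_poly: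
  "AE \<omega> in M. \<forall>\<^sub>F k in sequentially.
     norm (euler_product (offset k) (cutoff k) \<omega> - dirichlet_poly (offset k) (cutoff k) \<omega>) < 1"
proof -
  define A where "A k = {\<omega> \<in> space M. 1 \<le> norm (euler_product (offset k) (cutoff k) \<omega> - dirichlet_poly (offset k) (cutoff k) \<omega>)}" for k
  have "AE \<omega> in M. \<forall>\<^sub>F k in sequentially. \<omega> \<in> space M - A k"
  proof (rule borel_cantelli_AE1)
    show "A k \<in> events" for k
      unfolding A_def euler_product_minus_dirichlet_poly using measurable_mult_ext_z by measurable
    have "summable (\<lambda>k. exp (-1) ^ k :: real)" by (rule summable_geometric) simp
    then show "summable (\<lambda>k. prob (A k))"
    proof (rule summable_comparison_test'[where N = 0])
      fix k
      have "prob (A k) \<le> real (cutoff k) powr (-2 * offset k) / (2 * offset k)"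
        unfolding A_def using cutoff_bounds(3)[of k]
        by (intro prob_euler_product_far_from_dirichlet_poly offset_pos) auto
      also have "\<dots> \<le> exp (- real k)" by (rule cutoff_powr_tail)
      finally show "norm (prob (A k)) \<le> exp (-1) ^ k" by (simp add: exp_of_nat_mult [symmetric])
    qed
  qed (simp add: emeasure_eq_measure)
  then show ?thesis
  proof eventually_elim
    case (elim \<omega>)
    then show ?case by (rule eventually_mono) (auto simp: A_def not_le)
  qed
qed

text \<open>The old part has standard deviation of order \<open>fact k\<close>, whereas the
  threshold is \<open>d * fact (Suc k)\<close>, larger by a factor of order \<open>k\<close>. Only
  the lower tail can do damage, so Chernoff's bound is used with a negative parameter.\<close>

lemma eventually_old_primes_small:
  assumes d: "d > 0"
  shows "AE \<omega> in M. \<forall>\<^sub>F k in sequentially.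
    - d * fact (Suc k) < log_product (offset (Suc k)) (cutoff (Suc k)) (primes_upto (cutoff k)) \<omega>"
proof -
  obtain C where C: "C > 0" and mgf: "mgf_error C"
    using mgf_error_exists by blast
  define S where "S k = log_product (offset (Suc k)) (cutoff (Suc k)) (primes_upto (cutoff k))" for k
  define A where "A k = {\<omega> \<in> space M. S k \<omega> \<le> - d * fact (Suc k)}" for k
  have [measurable]: "random_variable borel (S k)" for k
    unfolding S_def by (intro measurable_log_product) (simp add: primes_upto_def)
  have "AE \<omega> in M. \<forall>\<^sub>F k in sequentially. \<omega> \<in> space M - A k"
  proof (rule borel_cantelli_AE1)
    show "A k \<in> events" for k unfolding A_def by measurable
    have "summable (\<lambda>k. exp (6 + C) * exp (- d) ^ k)"
      using d by (intro summable_mult summable_geometric) simp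
    then show "summable (\<lambda>k. prob (A k))"
    proof (rule summable_comparison_test'[where N = 0])
      fix k
      \<comment> \<open>The reciprocal of the standard deviation, up to a constant: the moment
        generating function stays below \<open>exp (6 + C)\<close>, with \<open>6 = 24 / 4\<close>,
        while the threshold contributes \<open>exp (- d * (k + 1))\<close>.\<close>
      define l :: real where "l = 1 / fact k"
      have l: "0 < l" "l \<le> 1" by (auto simp: l_def fact_ge_1)
      have ll: "l\<^sup>2 * level k = 1" by (simp add: l_def level_def power_divide)
      have lf: "l * fact (Suc k) = real k + 1" by (simp add: l_def)
      have int: "integrable M (\<lambda>\<omega>. exp (- l * S k \<omega>))"
        unfolding S_def using offset_pos[of "Suc k"] cutoff_bounds(3)[of "Suc k"]
        by (intro integrable_exp_log_product) (auto simp: primes_upto_def)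
      have "A k \<subseteq> {\<omega> \<in> space M. exp (d * (real k + 1)) \<le> exp (- l * S k \<omega>)}"
      proof
        fix \<omega> assume \<omega>: "\<omega> \<in> A k"
        then have "l * S k \<omega> \<le> l * (- d * fact (Suc k))"
          using l by (intro mult_left_mono) (auto simp: A_def)
        also have "\<dots> = - d * (l * fact (Suc k))" by (simp only: mult_ac)
        also have "\<dots> = - d * (real k + 1)" by (simp only: lf)
        finally show "\<omega> \<in> {\<omega> \<in> space M. exp (d * (real k + 1)) \<le> exp (- l * S k \<omega>)}"
          using \<omega> by (simp add: A_def)
      qed
      then have "prob (A k) \<le> prob {\<omega> \<in> space M. exp (d * (real k + 1)) \<le> exp (- l * S k \<omega>)}"
        by (intro finite_measure_mono) measurable
      also have "\<dots> \<le> expectation (\<lambda>\<omega>. exp (- l * S k \<omega>)) / exp (d * (real k + 1))"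
        by (rule integral_Markov_inequality_measure[where A = "{}"]) (use int in auto)
      also have "expectation (\<lambda>\<omega>. exp (- l * S k \<omega>))
         \<le> exp ((- l)\<^sup>2 * (\<Sum>p\<in>primes_upto (cutoff k). real p powr (-1 - 2 * offset (Suc k))) / 4 + C * \<bar>- l\<bar>)"
        unfolding S_def using offset_pos[of "Suc k"] cutoff_bounds(3)[of "Suc k"] l
        by (intro mgf_upper[OF mgf]) (auto simp: primes_upto_def)
      also have "\<dots> \<le> exp (6 + C)"
      proof -
        have "l\<^sup>2 * (\<Sum>p\<in>primes_upto (cutoff k). real p powr (-1 - 2 * offset (Suc k))) \<le> l\<^sup>2 * (24 * level k)"
          by (intro mult_left_mono old_variance_le) auto
        also have "\<dots> = 24" using ll by simp
        finally have "l\<^sup>2 * (\<Sum>p\<in>primes_upto (cutoff k). real p powr (-1 - 2 * offset (Suc k))) / 4 \<le> 6"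
          by simp
        moreover have "C * l \<le> C * 1" using l C by (intro mult_left_mono) auto
        ultimately show ?thesis using l by simp
      qed
      finally have "prob (A k) \<le> exp (6 + C) / exp (d * (real k + 1))" by (simp add: divide_right_mono)
      also have "\<dots> \<le> exp (6 + C) / exp (d * real k)" using d by (intro divide_left_mono) auto
      also have "\<dots> = exp (6 + C) * exp (- d) ^ k"
        by (simp add: exp_of_nat_mult [symmetric] exp_minus field_simps)
      finally show "norm (prob (A k)) \<le> exp (6 + C) * exp (- d) ^ k" by simp
    qed
  qed (simp add: emeasure_eq_measure)
  then show ?thesis
  proof eventually_elim
    case (elim \<omega>)
    then show ?case by (rule eventually_mono) (auto simp: A_def S_def not_le)
  qed
qed

lemma new_variance_asymptotics:
  assumes d: "0 < d" "d < 1"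
  shows "\<forall>\<^sub>F k in sequentially. (1 - d) * level (Suc k) \<le> new_variance k"
proof -
  have "\<forall>\<^sub>F k in sequentially. 30 / (real k + 1)\<^sup>2 < d"
    by (rule order_tendstoD(2)[where y = 0]) (real_asymp, rule d)
  then show ?thesis
  proof eventually_elim
    case (elim k)
    have "(1 - d) * level (Suc k) \<le> level (Suc k) * (1 - 30 / (real k + 1)\<^sup>2)"
      using elim level_ge(1)[of "Suc k"] by simp
    then show ?case using new_variance_ge[of k] by linarith
  qed
qed

text \<open>With \<open>s = (1 - 2 * d) * ln k\<close> the tilting bound has exponent
  \<open>- (1 + 2 * d) * s\<close>, just below \<open>ln k\<close> in size, so the probabilities
  dominate a multiple of the harmonic series. Distinct stages use disjoint sets of primes and are
  therefore independent.\<close>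

lemma frequently_new_primes_large:
  assumes d: "0 < d" "d < 1/2"
  shows "AE \<omega> in M. \<exists>\<^sub>F k in sequentially.
    (1 - d) * sqrt ((1 - 2 * d) * ln (real k) * new_variance k)
      \<le> log_product (offset (Suc k)) (cutoff (Suc k)) (new_primes k) \<omega>"
proof -
  obtain C where C: "C > 0" and mgf: "mgf_error C"
    using mgf_error_exists by blast
  define S where "S k = log_product (offset (Suc k)) (cutoff (Suc k)) (new_primes k)" for k
  define T where "T k = (1 - d) * sqrt ((1 - 2 * d) * ln (real k) * new_variance k)" for k
  define A where "A k = {\<omega> \<in> space M. \<not> T k \<le> S k \<omega>}" for k
  have np: "finite (new_primes k)" "new_primes k \<subseteq> {p. prime p}" for k
    by (auto simp: new_primes_def primes_upto_def)
  have meas [measurable]: "random_variable borel (S k)" for k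
    unfolding S_def by (intro measurable_log_product) (use np in auto)
  have compl: "1 - prob (A k) = prob {\<omega> \<in> space M. T k \<le> S k \<omega>}" for k
    unfolding A_def by (subst prob_neg) auto
  have ind: "indep_events A UNIV"
    unfolding A_def
  proof (rule indep_eventsI_indep_vars[where N = "\<lambda>_. borel" and X = S and P = "\<lambda>k x. \<not> T k \<le> x"])
    \<comment> \<open>\<open>S k\<close> rewritten as a measurable function of the coordinates in
      \<open>new_primes k\<close> alone, so that independence of disjoint blocks of \<open>z\<close>
      passes to the \<open>S k\<close>.\<close>
    define G where "G k x = (\<Sum>p\<in>new_primes k.
        ln (norm (\<Sum>j\<le>cutoff (Suc k). (x p * complex_of_real (real p powr (-1/2 - offset (Suc k)))) ^ j)))"
      for k and x :: "nat \<Rightarrow> complex"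
    have "disjoint_family new_primes"
    proof -
      have "new_primes k \<inter> new_primes l = {}" if "k < l" for k l
      proof -
        have "cutoff (Suc k) \<le> cutoff l" by (rule lift_Suc_mono_le[of cutoff, OF cutoff_bounds(4)]) (use that in simp)
        then show ?thesis by (auto simp: new_primes_def primes_upto_def)
      qed
      then show ?thesis unfolding disjoint_family_on_def by (metis Int_commute nat_neq_iff)
    qed
    then have "indep_vars (\<lambda>k. PiM (new_primes k) (\<lambda>_. borel)) (\<lambda>k \<omega>. restrict (\<lambda>p. z p \<omega>) (new_primes k)) UNIV"
      using np by (intro indep_vars_restrict[OF indep]) auto
    then have "indep_vars (\<lambda>_. borel) (\<lambda>k \<omega>. G k (restrict (\<lambda>p. z p \<omega>) (new_primes k))) UNIV"
    proof (rule indep_vars_compose2)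
      fix k show "G k \<in> borel_measurable (PiM (new_primes k) (\<lambda>_. borel))"
        unfolding G_def [abs_def] by measurable
    qed
    also have "(\<lambda>k \<omega>. G k (restrict (\<lambda>p. z p \<omega>) (new_primes k))) = S"
      by (simp add: G_def S_def fun_eq_iff log_product_def log_factor_def cong: sum.cong)
    finally show "indep_vars (\<lambda>_. borel) S UNIV" .
  qed auto
  \<comment> \<open>The solution of \<open>l\<^sup>2 * (W / 2) / 2 = s\<close> with
    \<open>W = new_variance k\<close>; then \<open>l * (W / 2) = sqrt (s * W)\<close> is the
    threshold without its factor \<open>1 - d\<close>. It tends to 0 because the variance outgrows
    \<open>ln k\<close>, so the error \<open>C * \<bar>u\<bar>\<close> for
    \<open>u \<le> 2 * l\<close> is eventually at most 1.\<close>
  define lam where "lam k = sqrt (4 * ((1 - 2 * d) * ln (real k)) / new_variance k)" for k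
  have half_less: "1 / 2 < (1 :: real)" by simp
  have lam0: "lam \<longlonglongrightarrow> 0"
  proof -
    have "(\<lambda>k. 4 * ((1 - 2 * d) * ln (real k)) / new_variance k) \<longlonglongrightarrow> 0"
    proof (rule real_tendsto_sandwich)
      have "\<forall>\<^sub>F k in sequentially. real k / 2 \<le> new_variance k \<and> k > 1"
        using new_variance_asymptotics[OF half_gt_zero[OF zero_less_one] half_less] eventually_gt_at_top[of 1]
      proof eventually_elim
        case (elim k) then show ?case using level_ge(2)[of "Suc k"] by auto
      qed
      then show "\<forall>\<^sub>F k in sequentially. 0 \<le> 4 * ((1 - 2 * d) * ln (real k)) / new_variance k"
        by eventually_elim (use d in auto)
      show "\<forall>\<^sub>F k in sequentially. 4 * ((1 - 2 * d) * ln (real k)) / new_variance k \<le> 8 * ln (real k) / real k"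
        using \<open>\<forall>\<^sub>F k in sequentially. real k / 2 \<le> new_variance k \<and> k > 1\<close>
      proof eventually_elim
        case (elim k)
        have "4 * ((1 - 2 * d) * ln (real k)) / new_variance k \<le> 4 * (1 * ln (real k)) / (real k / 2)"
          using elim d by (intro frac_le mult_left_mono mult_right_mono) auto
        then show ?case by simp
      qed
      show "(\<lambda>k. 8 * ln (real k) / real k) \<longlonglongrightarrow> 0" by real_asymp
    qed simp
    then have "(\<lambda>k. sqrt (4 * ((1 - 2 * d) * ln (real k)) / new_variance k)) \<longlonglongrightarrow> sqrt 0"
      by (rule tendsto_real_sqrt)
    then show ?thesis by (simp add: lam_def [abs_def])
  qed
  have ev: "\<forall>\<^sub>F k in sequentially. exp (-1) / 2 * (1 / real k) \<le> 1 - prob (A k)"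
  proof -
    have "\<forall>\<^sub>F k in sequentially. lam k < min (1 / 2) (1 / (2 * C))"
      by (rule order_tendstoD[OF lam0]) (use C in auto)
    moreover have "\<forall>\<^sub>F k in sequentially. 2 * exp (1 - d\<^sup>2 * ((1 - 2 * d) * ln (real k))) < exp (-1) / 2"
    proof (rule order_tendstoD)
      show "(\<lambda>k. 2 * exp (1 - d\<^sup>2 * ((1 - 2 * d) * ln (real k)))) \<longlonglongrightarrow> 0"
      proof -
        have "d\<^sup>2 * (1 - 2 * d) > 0" using d by simp
        then have "(\<lambda>k. 2 * exp (1 - (d\<^sup>2 * (1 - 2 * d)) * ln (real k))) \<longlonglongrightarrow> 0" by real_asymp
        then show ?thesis by (simp add: mult.assoc)
      qed
    qed simp
    moreover have "\<forall>\<^sub>F k in sequentially. (1 - 1/2) * level (Suc k) \<le> new_variance k"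
      by (rule new_variance_asymptotics) auto
    ultimately show ?thesis using eventually_gt_at_top[of 1]
    proof eventually_elim
      case (elim k)
      define W where "W = new_variance k"
      define s where "s = (1 - 2 * d) * ln (real k)"
      define l where "l = lam k"
      have W: "W > 0" using elim(3) level_ge(1)[of "Suc k"] by (simp add: W_def)
      have s: "s > 0" using elim d by (simp add: s_def)
      have l2: "l\<^sup>2 = 4 * s / W" using W s by (simp add: l_def lam_def s_def [symmetric] W_def [symmetric])
      have l0: "l > 0" using W s unfolding l_def lam_def s_def [symmetric] W_def [symmetric] by simp
      have "l < 1 / 2" "l < 1 / (2 * C)" using elim(1) by (auto simp: l_def)
      then have l: "l > 0" "2 * l \<le> 1" "C * (2 * l) \<le> 1"
        using l0 C by (auto simp: field_simps)
      have sl: "l\<^sup>2 * (W / 2) / 2 = s" using l2 W by simp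
      have lW: "l * (W / 2) = sqrt (s * W)"
      proof (rule real_sqrt_unique [symmetric])
        show "(l * (W / 2))\<^sup>2 = s * W"
          unfolding power_mult_distrib l2 using W by (simp add: power2_eq_square)
      qed (use l W in auto)
      have "exp (- (1 + 2 * d) * (l\<^sup>2 * (W / 2) / 2)) * (exp (- 1) - 2 * exp (1 - d\<^sup>2 * (l\<^sup>2 * (W / 2) / 2)))
         \<le> prob {x \<in> space M. S k x \<ge> (1 - d) * (l * (W / 2))}"
      proof (rule prob_ge_by_tilting[OF meas _ l(1)])
        fix u
        show "integrable M (\<lambda>x. exp (u * S k x))"
          unfolding S_def using np offset_pos[of "Suc k"] cutoff_bounds(3)[of "Suc k"]
          by (intro integrable_exp_log_product) auto
        assume u: "0 \<le> u" "u \<le> 2 * l"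
        have "expectation (\<lambda>x. exp (u * S k x)) \<le> exp (u\<^sup>2 * W / 4 + C * \<bar>u\<bar>)"
          unfolding S_def W_def new_variance_def
          using mgf_upper[OF mgf np, of "offset (Suc k)" "cutoff (Suc k)" u] offset_pos[of "Suc k"] cutoff_bounds(3)[of "Suc k"] u l
          by auto
        also have "\<dots> \<le> exp (u\<^sup>2 * (W / 2) / 2 + 1)"
          using u order_trans[OF mult_left_mono[OF u(2), of C] l(3)] C by simp
        finally show "expectation (\<lambda>x. exp (u * S k x)) \<le> exp (u\<^sup>2 * (W / 2) / 2 + 1)" .
      next
        have Cl: "C * l \<le> 1" using l C by (simp add: mult.left_commute)
        have "exp (l\<^sup>2 * (W / 2) / 2 - 1) \<le> exp (l\<^sup>2 * W / 4 - C * \<bar>l\<bar>)"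
          using l Cl by simp
        also have "\<dots> \<le> expectation (\<lambda>x. exp (l * S k x))"
          unfolding S_def W_def new_variance_def
          using mgf_lower[OF mgf np, of "offset (Suc k)" "cutoff (Suc k)" l] offset_pos[of "Suc k"] cutoff_bounds(3)[of "Suc k"] l Cl
          by auto
        finally show "exp (l\<^sup>2 * (W / 2) / 2 - 1) \<le> expectation (\<lambda>x. exp (l * S k x))" .
      qed (use d in auto)
      then have *: "exp (- (1 + 2 * d) * s) * (exp (- 1) - 2 * exp (1 - d\<^sup>2 * s)) \<le> 1 - prob (A k)"
        unfolding compl sl lW T_def s_def [symmetric] W_def [symmetric] .
      have "exp (-1) / 2 * (1 / real k) = exp (- ln (real k)) * (exp (-1) / 2)"
        using elim by (simp add: exp_minus field_simps)
      also have "\<dots> \<le> exp (- (1 + 2 * d) * s) * (exp (- 1) - 2 * exp (1 - d\<^sup>2 * s))"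
      proof (intro mult_mono)
        \<comment> \<open>The loss \<open>1 + 2 * d\<close> from tilting is compensated by the
          factor \<open>1 - 2 * d\<close> in the choice of \<open>s\<close>.\<close>
        have "(1 + 2 * d) * s = (1 - 4 * d\<^sup>2) * ln (real k)"
          by (simp add: s_def algebra_simps power2_eq_square)
        also have "\<dots> \<le> 1 * ln (real k)" using elim by (intro mult_right_mono) auto
        finally show "exp (- ln (real k)) \<le> exp (- (1 + 2 * d) * s)"
          unfolding exp_le_cancel_iff mult_minus_left by simp
        show "exp (-1) / 2 \<le> exp (- 1) - 2 * exp (1 - d\<^sup>2 * s)"
          using elim(2) unfolding s_def by linarith
      qed auto
      also note *
      finally show ?case .
    qed
  qed
  have "\<not> summable (\<lambda>k. 1 - prob (A k))"
  proof
    assume "summable (\<lambda>k. 1 - prob (A k))"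
    have "summable (\<lambda>k. exp (-1) / 2 * (1 / real k))"
      by (rule summable_comparison_test_ev[OF _ \<open>summable (\<lambda>k. 1 - prob (A k))\<close>])
         (rule eventually_mono[OF ev], simp)
    then have "summable (\<lambda>k. inverse (real k))"
      by (subst (asm) summable_cmult_iff) (simp add: inverse_eq_divide)
    then show False using not_summable_harmonic[where 'a = real] by simp
  qed
  from borel_cantelli_AE2[OF ind this] AE_space show ?thesis
  proof eventually_elim
    case (elim \<omega>)
    from elim(1) show ?case
      by (rule frequently_elim1) (use elim(2) in \<open>auto simp: A_def S_def T_def\<close>)
  qed
qed

end

section \<open>Large partial sums\<close>

text \<open>The partial sums are bounded by \<open>C1 + B + offset k * ln n\<close>, with three
  cases for \<open>x = ln (ln n)\<close>. Finitely many \<open>n\<close> go into \<open>C1\<close>.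
  For \<open>x \<le> (1 + e) * level k\<close> monotonicity gives \<open>B\<close>. Beyond that the
  assumed bound is at most \<open>exp (x - level k) = offset k * ln n\<close>. The constant depends
  on \<open>a\<close> but not on the stage.\<close>

lemma norm_dirichlet_sum_le:
  fixes a :: "nat \<Rightarrow> complex"
  assumes e: "0 < e" "e < 1"
    and ev: "\<forall>\<^sub>F n in sequentially. norm (\<Sum>j\<in>{1..n}. a j)
      \<le> exp ((1 - e) * sqrt (ln (ln (real n)) * ln (ln (ln (ln (real n))))))"
  shows "\<exists>C. \<forall>k N. norm (\<Sum>n\<in>{1..N}. of_real (real n powr (- offset k)) * a n)
    \<le> C + exp ((1 - e) * sqrt ((1 + e) * level k * ln (ln ((1 + e) * level k))))"
proof -
  \<comment> \<open>Solves \<open>(1 - \<theta>) * (1 + e) = 1\<close>, so that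
    \<open>x > (1 + e) * level k\<close> gives
    \<open>\<theta> * x \<le> x - level k\<close>.\<close>
  define \<theta> where "\<theta> = e / (1 + e)"
  have \<theta>: "0 < \<theta>" "(1 - \<theta>) * (1 + e) = 1" using e by (auto simp: \<theta>_def field_simps)
  have loglog: "filterlim (\<lambda>n. ln (ln (real n))) at_top sequentially" by real_asymp
  have "\<forall>\<^sub>F x :: real in at_top. ln (ln x) / x < \<theta>\<^sup>2"
    by (rule order_tendstoD(2)[where y = 0]) (real_asymp, use \<theta> in simp)
  then have "\<forall>\<^sub>F x :: real in at_top. x > 0 \<and> sqrt (x * ln (ln x)) \<le> \<theta> * x"
    using eventually_gt_at_top[of 0]
  proof eventually_elim
    case (elim x)
    then have "x * ln (ln x) \<le> (\<theta> * x)\<^sup>2" by (simp add: divide_less_eq power2_eq_square algebra_simps)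
    then have "sqrt (x * ln (ln x)) \<le> sqrt ((\<theta> * x)\<^sup>2)" by (rule real_sqrt_le_mono)
    then show ?case using elim \<theta> by simp
  qed
  then have small: "\<forall>\<^sub>F n in sequentially. sqrt (ln (ln (real n)) * ln (ln (ln (ln (real n))))) \<le> \<theta> * ln (ln (real n))"
    using filterlim_iff[THEN iffD1, OF loglog] by (auto elim: eventually_mono)
  \<comment> \<open>Ensures \<open>ln x \<ge> 1\<close> and \<open>ln (ln x) \<ge> 0\<close> for
    \<open>x = ln (ln n)\<close>; outside this range the iterated logarithms are neither nonnegative
    nor monotone.\<close>
  have big: "\<forall>\<^sub>F n in sequentially. exp 1 \<le> ln (ln (real n))"
    using loglog by (simp add: filterlim_at_top)
  obtain n1 where n1: "\<And>n. n \<ge> n1 \<Longrightarrow> norm (\<Sum>j\<in>{1..n}. a j)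
      \<le> exp ((1 - e) * sqrt (ln (ln (real n)) * ln (ln (ln (ln (real n))))))"
    "\<And>n. n \<ge> n1 \<Longrightarrow> sqrt (ln (ln (real n)) * ln (ln (ln (ln (real n))))) \<le> \<theta> * ln (ln (real n))"
    "\<And>n. n \<ge> n1 \<Longrightarrow> exp 1 \<le> ln (ln (real n))"
    "n1 \<ge> 3"
    using eventually_conj[OF ev eventually_conj[OF small eventually_conj[OF big eventually_ge_at_top[of 3]]]]
    unfolding eventually_sequentially by (metis order_refl)
  define C1 where "C1 = (\<Sum>n<n1. norm (\<Sum>j\<in>{1..n}. a j))"
  have C1: "C1 \<ge> 0" unfolding C1_def by (intro sum_nonneg) auto
  have "norm (\<Sum>n\<in>{1..N}. of_real (real n powr (- offset k)) * a n)
    \<le> (C1 + 2) + exp ((1 - e) * sqrt ((1 + e) * level k * ln (ln ((1 + e) * level k))))" for k N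
  proof -
    define B where "B = exp ((1 - e) * sqrt ((1 + e) * level k * ln (ln ((1 + e) * level k))))"
    have B: "B > 0" by (simp add: B_def)
    have "norm (\<Sum>n\<in>{1..N}. of_real (real n powr (- offset k)) * a n)
      \<le> (C1 + B) + offset k * (1 + 1 / offset k)"
    proof (rule norm_sum_powr_le)
      fix n assume n: "n \<in> {1..N}"
      then have lnn: "ln (real n) \<ge> 0" by simp
      define x where "x = ln (ln (real n))"
      consider "n < n1" | "n \<ge> n1" "x \<le> (1 + e) * level k" | "n \<ge> n1" "x > (1 + e) * level k"
        by linarith
      then show "norm (\<Sum>j\<in>{1..n}. a j) \<le> C1 + B + offset k * ln (real n)"
      proof cases
        case 1
        then have "norm (\<Sum>j\<in>{1..n}. a j) \<le> C1" unfolding C1_def by (intro member_le_sum) auto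
        also have "\<dots> \<le> C1 + B + offset k * ln (real n)" using B lnn offset_pos[of k] by simp
        finally show ?thesis .
      next
        case 2
        have x: "exp 1 \<le> x" using n1(3) 2 by (simp add: x_def)
        then have x0: "0 < x" "1 < x" using exp_ge_add_one_self[of "1::real"] by linarith+
        have lx: "1 \<le> ln x" using x x0 by (simp add: ln_ge_iff)
        have "ln (ln x) \<le> ln (ln ((1 + e) * level k))"
          using 2(2) x0 lx by (intro ln_mono) (auto intro: less_le_trans)
        then have "x * ln (ln x) \<le> (1 + e) * level k * ln (ln ((1 + e) * level k))"
          using 2(2) x0 lx by (intro mult_mono) auto
        then have "(1 - e) * sqrt (x * ln (ln x)) \<le> (1 - e) * sqrt ((1 + e) * level k * ln (ln ((1 + e) * level k)))"
          using e by (intro mult_left_mono real_sqrt_le_mono) auto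
        then have "norm (\<Sum>j\<in>{1..n}. a j) \<le> B"
          using n1(1)[OF 2(1)] unfolding x_def [symmetric] B_def by (meson exp_le_cancel_iff order_trans)
        also have "\<dots> \<le> C1 + B + offset k * ln (real n)" using C1 lnn offset_pos[of k] by simp
        finally show ?thesis .
      next
        case 3
        have x: "exp 1 \<le> x" using n1(3) 3 by (simp add: x_def)
        then have x0: "0 < x" "1 < x" using exp_ge_add_one_self[of "1::real"] by linarith+
        have lx: "1 \<le> ln x" using x x0 by (simp add: ln_ge_iff)
        have lnpos: "ln (real n) > 0" using 3 n1(4) by simp
        have "(1 - e) * sqrt (x * ln (ln x)) \<le> 1 * (\<theta> * x)"
          using n1(2)[OF 3(1)] e x0 lx \<theta> unfolding x_def [symmetric] by (intro mult_mono) auto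
        also have "\<dots> = x - (1 - \<theta>) * x" by (simp add: algebra_simps)
        also have "\<dots> \<le> x - level k"
        proof -
          have "0 \<le> 1 - \<theta>" using e by (simp add: \<theta>_def)
          then have "(1 - \<theta>) * ((1 + e) * level k) \<le> (1 - \<theta>) * x" using 3 by (intro mult_left_mono) auto
          then show ?thesis using \<theta>(2) by (simp add: mult.assoc [symmetric])
        qed
        finally have "norm (\<Sum>j\<in>{1..n}. a j) \<le> exp (x - level k)"
          using n1(1)[OF 3(1)] unfolding x_def [symmetric] by (meson exp_le_cancel_iff order_trans)
        also have "\<dots> = offset k * ln (real n)"
          using lnpos by (simp add: exp_diff x_def offset_def exp_minus field_simps)
        also have "\<dots> \<le> C1 + B + offset k * ln (real n)" using B C1 by simp
        finally show ?thesis .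
      qed
    qed (use offset_pos[of k] C1 B in auto)
    also have "offset k * (1 + 1 / offset k) = offset k + 1"
      using offset_pos[of k] by (simp add: field_simps)
    also have "offset k \<le> 1" using level_ge(1)[of k] by (simp add: offset_def)
    finally show ?thesis by (simp add: B_def)
  qed
  then show ?thesis by blast
qed

text \<open>From \<open>fact m \<le> m ^ m\<close> it follows that
  \<open>ln (ln (level (Suc k)))\<close> is at most \<open>(1 + e) * ln k\<close>, with room for the
  factor \<open>1 + e\<close>. The two factors \<open>1 + e\<close> under the root leave
  \<open>1 + e\<close>, and \<open>(1 - e) * (1 + e) = 1 - e\<^sup>2\<close> is still below 1: this
  is the gap that the contradiction exploits.\<close>

lemma level_growth:
  assumes e: "0 < e" "e < 1"
  shows "\<forall>\<^sub>F k in sequentially.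
    (1 - e) * sqrt ((1 + e) * level (Suc k) * ln (ln ((1 + e) * level (Suc k))))
      \<le> (1 - e\<^sup>2) * (fact (Suc k) * sqrt (ln (real k)))"
proof -
  have "\<forall>\<^sub>F k in sequentially. ln (ln 2 + 2 * (real k + 1) * ln (real k + 1)) \<le> (1 + e) * ln (real k)"
    using e by real_asymp
  then show ?thesis using eventually_ge_at_top[of 3]
  proof eventually_elim
    case (elim k)
    have "fact (Suc k) \<le> real (Suc k) ^ Suc k"
      using fact_le_power[where n = "Suc k" and 'a = real] by (simp del: fact_Suc power_Suc)
    then have "ln (fact (Suc k) :: real) \<le> ln (real (Suc k) ^ Suc k)" by (intro ln_mono) auto
    also have "\<dots> = (real k + 1) * ln (real k + 1)" by (subst ln_realpow) (auto simp: add.commute)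
    finally have lf: "ln (fact (Suc k) :: real) \<le> (real k + 1) * ln (real k + 1)" .
    have "3 \<le> level (Suc k)" using elim level_ge(2)[of "Suc k"] by simp
    moreover have "level (Suc k) \<le> (1 + e) * level (Suc k)" using e level_ge(1)[of "Suc k"] by simp
    ultimately have ge3: "3 \<le> (1 + e) * level (Suc k)" by linarith
    then have "ln 3 \<le> ln ((1 + e) * level (Suc k))" by (intro ln_mono) auto
    moreover have "1 \<le> ln (3::real)" using exp_le by (simp add: ln_ge_iff)
    ultimately have ln1: "1 \<le> ln ((1 + e) * level (Suc k))" by linarith
    have "ln ((1 + e) * level (Suc k)) \<le> ln (2 * level (Suc k))"
      using ge3 e level_ge(1)[of "Suc k"] by (intro ln_mono mult_right_mono) auto
    also have "\<dots> = ln 2 + 2 * ln (fact (Suc k))"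
      unfolding level_def by (subst ln_mult) (auto simp: ln_realpow simp del: fact_Suc)
    also have "\<dots> \<le> ln 2 + 2 * (real k + 1) * ln (real k + 1)" using lf unfolding mult.assoc by linarith
    finally have "ln (ln ((1 + e) * level (Suc k))) \<le> ln (ln 2 + 2 * (real k + 1) * ln (real k + 1))"
      using ln1 by (intro ln_mono) auto
    with elim have "ln (ln ((1 + e) * level (Suc k))) \<le> (1 + e) * ln (real k)" by linarith
    then have "(1 + e) * level (Suc k) * ln (ln ((1 + e) * level (Suc k))) \<le> (1 + e) * level (Suc k) * ((1 + e) * ln (real k))"
      using ge3 by (intro mult_left_mono) auto
    also have "\<dots> = ((1 + e) * fact (Suc k))\<^sup>2 * ln (real k)"
      by (simp add: level_def power2_eq_square mult_ac del: fact_Suc)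
    finally have "sqrt ((1 + e) * level (Suc k) * ln (ln ((1 + e) * level (Suc k))))
        \<le> sqrt (((1 + e) * fact (Suc k))\<^sup>2 * ln (real k))" by (rule real_sqrt_le_mono)
    also have "\<dots> = (1 + e) * fact (Suc k) * sqrt (ln (real k))"
      using e by (simp add: real_sqrt_mult del: fact_Suc)
    finally have "(1 - e) * sqrt ((1 + e) * level (Suc k) * ln (ln ((1 + e) * level (Suc k))))
        \<le> (1 - e) * ((1 + e) * fact (Suc k) * sqrt (ln (real k)))"
      using e by (intro mult_left_mono) auto
    also have "\<dots> = (1 - e\<^sup>2) * (fact (Suc k) * sqrt (ln (real k)))"
      by (simp add: power2_eq_square algebra_simps del: fact_Suc)
    finally show ?case .
  qed
qed

lemma exp_gap_eventually:
  fixes b c C :: real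
  assumes "0 < b" "b < c"
  shows "\<forall>\<^sub>F k in sequentially. C + exp (b * (fact (Suc k) * sqrt (ln (real k)))) \<le> exp (c * (fact (Suc k) * sqrt (ln (real k))))"
proof -
  have "filterlim (\<lambda>k. fact (Suc k) * sqrt (ln (real k))) at_top sequentially"
  proof (rule filterlim_at_top_mono)
    show "filterlim (\<lambda>k. sqrt (ln (real k))) at_top sequentially" by real_asymp
    show "\<forall>\<^sub>F k in sequentially. sqrt (ln (real k)) \<le> fact (Suc k) * sqrt (ln (real k))"
      using eventually_ge_at_top[of 1]
    proof eventually_elim
      case (elim k)
      then show ?case using mult_right_mono[OF fact_ge_1[of "Suc k"], of "sqrt (ln (real k))"] by simp
    qed
  qed
  moreover have "\<forall>\<^sub>F x in at_top. C + exp (b * x) \<le> exp (c * x)"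
    using assms by real_asymp
  ultimately show ?thesis by (auto simp: filterlim_iff)
qed

context steinhaus_primes
begin

text \<open>The three almost sure statements are combined at stage \<open>Suc k\<close>: new primes
  large infinitely often, old primes harmless eventually, Dirichlet polynomial eventually within 1
  of the product.\<close>

lemma frequently_dirichlet_poly_large:
  assumes d: "0 < d" "d < 1/2"
  shows "AE \<omega> in M. \<exists>\<^sub>F k in sequentially.
    exp ((1 - 5 * d) * (fact (Suc k) * sqrt (ln (real k))))
      < norm (dirichlet_poly (offset (Suc k)) (cutoff (Suc k)) \<omega>) + 1"
  using eventually_euler_product_near_dirichlet_poly eventually_old_primes_small[OF d(1)]
    frequently_new_primes_large[OF d]
proof eventually_elim
  case (elim \<omega>)
  have near: "\<forall>\<^sub>F k in sequentially.
     norm (euler_product (offset (Suc k)) (cutoff (Suc k)) \<omega> - dirichlet_poly (offset (Suc k)) (cutoff (Suc k)) \<omega>) < 1"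
    using elim(1) by (subst eventually_sequentially_Suc)
  have var: "\<forall>\<^sub>F k in sequentially. (1 - d) * level (Suc k) \<le> new_variance k"
    using d by (intro new_variance_asymptotics) auto
  from elim(3) show ?case
  proof (rule frequently_rev_mp)
    show "\<forall>\<^sub>F k in sequentially. (1 - d) * sqrt ((1 - 2 * d) * ln (real k) * new_variance k)
        \<le> log_product (offset (Suc k)) (cutoff (Suc k)) (new_primes k) \<omega> \<longrightarrow>
      exp ((1 - 5 * d) * (fact (Suc k) * sqrt (ln (real k))))
      < norm (dirichlet_poly (offset (Suc k)) (cutoff (Suc k)) \<omega>) + 1"
      using near elim(2) var eventually_ge_at_top[of 3]
    proof eventually_elim
      case (elim k)
      define X where "X = fact (Suc k) * sqrt (ln (real k))"
      have "ln 3 \<le> ln (real k)" using elim(4) by (intro ln_mono) auto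
      moreover have "1 \<le> ln (3::real)" using exp_le by (simp add: ln_ge_iff)
      ultimately have lnk: "1 \<le> ln (real k)" by linarith
      have FX: "fact (Suc k) \<le> X" "0 \<le> X"
        using mult_left_mono[of 1 "sqrt (ln (real k))" "fact (Suc k)"] lnk by (auto simp: X_def simp del: fact_Suc)
      have "((1 - 2 * d) * (1 - d) * X)\<^sup>2 = ((1 - 2 * d) * (1 - 2 * d)) * ln (real k) * ((1 - d) * (1 - d) * level (Suc k))"
        using lnk by (simp add: X_def level_def power_mult_distrib power2_eq_square mult_ac del: fact_Suc)
      also have "\<dots> \<le> ((1 - 2 * d) * 1) * ln (real k) * (1 * ((1 - d) * level (Suc k)))"
        unfolding mult.assoc using d lnk level_ge(1)[of "Suc k"]
        by (intro mult_mono mult_nonneg_nonneg) auto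
      also have "\<dots> \<le> (1 - 2 * d) * ln (real k) * new_variance k"
        using elim(3) d lnk by (simp add: mult_left_mono)
      finally have "(1 - 2 * d) * (1 - d) * X \<le> sqrt ((1 - 2 * d) * ln (real k) * new_variance k)"
        by (rule real_le_rsqrt)
      then have "(1 - d) * ((1 - 2 * d) * (1 - d) * X) \<le> (1 - d) * sqrt ((1 - 2 * d) * ln (real k) * new_variance k)"
        using d by (intro mult_left_mono) auto
      \<comment> \<open>The factor \<open>(1 - d)\<^sup>2 * (1 - 2 * d)\<close> collects the
        threshold, the variance and the factor of \<open>ln k\<close>; the fifth \<open>d\<close> in
        the statement pays for the old primes.\<close>
      moreover have "(1 - 4 * d) * X \<le> (1 - d) * ((1 - 2 * d) * (1 - d) * X)"
      proof -
        have "(1 - d) * ((1 - 2 * d) * (1 - d)) - (1 - 4 * d) = d\<^sup>2 * (5 - 2 * d)"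
          by (simp add: power2_eq_square algebra_simps)
        also have "\<dots> \<ge> 0" using d by simp
        finally have "1 - 4 * d \<le> (1 - d) * ((1 - 2 * d) * (1 - d))" by simp
        then have "(1 - 4 * d) * X \<le> ((1 - d) * ((1 - 2 * d) * (1 - d))) * X"
          using FX(2) by (rule mult_right_mono)
        then show ?thesis by (simp only: mult.assoc)
      qed
      ultimately have "(1 - 4 * d) * X \<le> (1 - d) * sqrt ((1 - 2 * d) * ln (real k) * new_variance k)"
        by (rule order_trans[rotated])
      moreover have "d * fact (Suc k) \<le> d * X" using FX d by (intro mult_left_mono) auto
      ultimately have "(1 - 4 * d) * X - d * X \<le> (1 - d) * sqrt ((1 - 2 * d) * ln (real k) * new_variance k) - d * fact (Suc k)"
        by (rule diff_mono)
      also have "(1 - 4 * d) * X - d * X = (1 - 5 * d) * X" by (simp add: algebra_simps)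
      finally have main: "(1 - 5 * d) * X \<le> (1 - d) * sqrt ((1 - 2 * d) * ln (real k) * new_variance k) - d * fact (Suc k)" .
      have sub: "primes_upto (cutoff k) \<subseteq> primes_upto (cutoff (Suc k))"
        using cutoff_bounds(4)[of k] by (auto simp: primes_upto_def)
      have split: "log_product (offset (Suc k)) (cutoff (Suc k)) (primes_upto (cutoff (Suc k))) \<omega>
        = log_product (offset (Suc k)) (cutoff (Suc k)) (new_primes k) \<omega>
          + log_product (offset (Suc k)) (cutoff (Suc k)) (primes_upto (cutoff k)) \<omega>"
        unfolding log_product_def new_primes_def by (rule sum.subset_diff[OF sub]) simp
      have euler: "norm (euler_product (offset (Suc k)) (cutoff (Suc k)) \<omega>)
          = exp (log_product (offset (Suc k)) (cutoff (Suc k)) (primes_upto (cutoff (Suc k))) \<omega>)"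
        using offset_pos[of "Suc k"] cutoff_bounds(3)[of "Suc k"] by (intro norm_euler_product) auto
      have "norm (euler_product (offset (Suc k)) (cutoff (Suc k)) \<omega>) < norm (dirichlet_poly (offset (Suc k)) (cutoff (Suc k)) \<omega>) + 1"
        using elim(1) norm_triangle_ineq2[of "euler_product (offset (Suc k)) (cutoff (Suc k)) \<omega>" "dirichlet_poly (offset (Suc k)) (cutoff (Suc k)) \<omega>"]
        by linarith
      moreover have "exp ((1 - 5 * d) * X) \<le> norm (euler_product (offset (Suc k)) (cutoff (Suc k)) \<omega>)"
        if "(1 - d) * sqrt ((1 - 2 * d) * ln (real k) * new_variance k)
          \<le> log_product (offset (Suc k)) (cutoff (Suc k)) (new_primes k) \<omega>"
        unfolding euler split exp_le_cancel_iff diff_conv_add_uminus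
        by (rule order_trans[OF main[unfolded diff_conv_add_uminus]])
           (rule add_mono[OF that[unfolded diff_conv_add_uminus]], use elim(2) in \<open>simp del: fact_Suc\<close>)
      ultimately show ?case unfolding X_def [symmetric] by (meson le_less_trans)
    qed
  qed
qed

lemma not_eventually_partial_sums_small:
  assumes e: "0 < e" "e < 1"
  shows "AE \<omega> in M. \<not> (\<forall>\<^sub>F n in sequentially.
    norm (\<Sum>j\<in>{1..n}. mult_ext (\<lambda>p. z p \<omega>) j / of_real (sqrt (real j)))
      \<le> exp ((1 - e) * sqrt (ln (ln (real n)) * ln (ln (ln (ln (real n)))))))"
proof -
  \<comment> \<open>Gives \<open>5 * d = e\<^sup>2 / 2\<close>, so the lower exponent
    \<open>1 - 5 * d\<close> strictly exceeds the upper exponent \<open>1 - e\<^sup>2\<close>, and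
    additive constants are absorbed by \<open>exp_gap_eventually\<close>.\<close>
  define d where "d = e\<^sup>2 / 10"
  have "e\<^sup>2 < 1" using e by (simp add: power_less_one_iff abs_square_less_1)
  then have d: "0 < d" "d < 1/2" using e by (auto simp: d_def)
  from frequently_dirichlet_poly_large[OF d] show ?thesis
  proof eventually_elim
    case (elim \<omega>)
    define a where "a j = mult_ext (\<lambda>p. z p \<omega>) j / of_real (sqrt (real j))" for j
    have dir: "dirichlet_poly s N \<omega> = (\<Sum>n\<in>{1..N}. of_real (real n powr (- s)) * a n)" for s N
      unfolding dirichlet_poly_def
    proof (rule sum.cong[OF refl])
      fix n assume "n \<in> {1..N}"
      then have n: "real n > 0" by simp
      have "real n powr (-1/2 - s) = real n powr (- s + - (1/2))"
        by (rule arg_cong[where f = "\<lambda>x. real n powr x"]) simp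
      also have "\<dots> = real n powr (- s) * inverse (real n powr (1/2))"
        by (simp only: powr_add powr_minus)
      also have "\<dots> = real n powr (- s) / sqrt (real n)"
        unfolding powr_half_sqrt[OF less_imp_le[OF n]] by (rule divide_inverse[symmetric])
      finally have "real n powr (-1/2 - s) = real n powr (- s) / sqrt (real n)" .
      then show "of_real (real n powr (-1/2 - s)) * mult_ext (\<lambda>p. z p \<omega>) n = of_real (real n powr (- s)) * a n"
        by (simp add: a_def)
    qed
    show ?case
    proof
      assume "\<forall>\<^sub>F n in sequentially.
        norm (\<Sum>j\<in>{1..n}. mult_ext (\<lambda>p. z p \<omega>) j / of_real (sqrt (real j)))
          \<le> exp ((1 - e) * sqrt (ln (ln (real n)) * ln (ln (ln (ln (real n))))))"
      from norm_dirichlet_sum_le[OF e this] obtain C where C: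
        "norm (dirichlet_poly (offset k) N \<omega>)
          \<le> C + exp ((1 - e) * sqrt ((1 + e) * level k * ln (ln ((1 + e) * level k))))" for k N
        unfolding dir a_def by blast
      have gap: "\<forall>\<^sub>F k in sequentially. (C + 1) + exp ((1 - e\<^sup>2) * (fact (Suc k) * sqrt (ln (real k))))
          \<le> exp ((1 - 5 * d) * (fact (Suc k) * sqrt (ln (real k))))"
        using \<open>e\<^sup>2 < 1\<close> e by (intro exp_gap_eventually) (auto simp: d_def)
      have "\<forall>\<^sub>F k in sequentially. \<not> exp ((1 - 5 * d) * (fact (Suc k) * sqrt (ln (real k))))
          < norm (dirichlet_poly (offset (Suc k)) (cutoff (Suc k)) \<omega>) + 1"
        using gap level_growth[OF e]
      proof eventually_elim
        case (elim k)
        have "exp ((1 - e) * sqrt ((1 + e) * level (Suc k) * ln (ln ((1 + e) * level (Suc k)))))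
          \<le> exp ((1 - e\<^sup>2) * (fact (Suc k) * sqrt (ln (real k))))"
          using elim(2) by simp
        with elim(1) C[of "Suc k" "cutoff (Suc k)"] show ?case by linarith
      qed
      with elim show False by (simp add: frequently_def)
    qed
  qed
qed

end

section \<open>Steinhaus random multiplicative functions\<close>

lemma unit_circle_measure_eq:
  "unit_circle_measure = distr (density lborel (\<lambda>x. ennreal (indicator {0..<2 * pi} x / (2 * pi)))) borel cis"
proof -
  have "indicator {0..<2 * pi} x / emeasure lborel {0..<2 * pi} = ennreal (indicator {0..<2 * pi} x / (2 * pi))" for x
    by (cases "x \<in> {0..<2 * pi}") (auto simp: divide_ennreal ennreal_1 [symmetric] simp del: ennreal_1)
  then show ?thesis unfolding unit_circle_measure_def uniform_measure_def by simp
qed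

lemma borel_measurable_cis [measurable]: "cis \<in> borel_measurable borel"
  by (intro borel_measurable_continuous_onI continuous_on_cis continuous_on_id)

text \<open>The antiderivative \<open>cis (k * t) / (\<i> * k)\<close> is periodic with period
  \<open>2 * pi\<close>.\<close>

lemma integral_cis_multiple:
  fixes k :: nat
  assumes "k > 0"
  shows "(LINT t|lborel. indicator {0..2 * pi} t *\<^sub>R (cis t ^ k)) = 0"
proof -
  define F where "F t = cis (real k * t) / (\<i> * of_nat k)" for t
  have "has_bochner_integral lborel (\<lambda>t. indicator {0..2 * pi} t *\<^sub>R (cis t ^ k)) (F (2 * pi) - F 0)"
  proof (rule has_bochner_integral_FTC_Icc)
    show "(F has_vector_derivative cis t ^ k) (at t within {0..2 * pi})" for t
    proof -
      have "((\<lambda>t. exp (t *\<^sub>R (\<i> * of_nat k)) / (\<i> * of_nat k)) has_vector_derivative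
          exp (t *\<^sub>R (\<i> * of_nat k)) * (\<i> * of_nat k) / (\<i> * of_nat k)) (at t within {0..2 * pi})"
        by (intro has_vector_derivative_divide exp_scaleR_has_vector_derivative_right)
      moreover have "exp (t *\<^sub>R (\<i> * of_nat k)) = cis (real k * t)" for t
        by (simp add: cis_conv_exp scaleR_conv_of_real mult_ac)
      ultimately show ?thesis using assms unfolding F_def [abs_def] Complex.DeMoivre by simp
    qed
    show "continuous_on {0..2 * pi} (\<lambda>t. cis t ^ k)"
      by (intro continuous_intros)
  qed simp
  moreover have "F (2 * pi) = F 0"
  proof -
    have "cis (real k * (2 * pi)) = cis (2 * pi) ^ k" by (rule Complex.DeMoivre [symmetric])
    then show ?thesis by (simp only: F_def cis_2pi) simp
  qed
  ultimately show ?thesis by (simp add: has_bochner_integral_iff)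
qed

lemma moments_unit_circle_measure:
  fixes k :: nat
  assumes "k > 0"
  shows "integral\<^sup>L unit_circle_measure (\<lambda>x. x ^ k) = 0"
proof -
  have "integral\<^sup>L unit_circle_measure (\<lambda>x. x ^ k) = (LINT t|lborel. (indicator {0..<2 * pi} t / (2 * pi)) *\<^sub>R (cis t ^ k))"
    unfolding unit_circle_measure_eq by (subst integral_distr) (auto simp: integral_density)
  also have "\<dots> = (LINT t|lborel. (1 / (2 * pi)) *\<^sub>R (indicator {0..2 * pi} t *\<^sub>R (cis t ^ k)))"
  proof (rule integral_cong_AE)
    \<comment> \<open>The law lives on the half-open interval, whereas the fundamental theorem of
      calculus was applied on the closed one; they differ by a null set.\<close>
    have "AE t in lborel. t \<noteq> 2 * pi" by (rule AE_lborel_singleton)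
    then show "AE t in lborel. (indicator {0..<2 * pi} t / (2 * pi)) *\<^sub>R (cis t ^ k)
        = (1 / (2 * pi)) *\<^sub>R (indicator {0..2 * pi} t *\<^sub>R (cis t ^ k))"
      by eventually_elim (auto simp: indicator_def)
  qed auto
  also have "\<dots> = (1 / (2 * pi)) *\<^sub>R (LINT t|lborel. indicator {0..2 * pi} t *\<^sub>R (cis t ^ k))"
    by (rule integral_scaleR_right)
  also have "\<dots> = 0" unfolding integral_cis_multiple[OF assms] by simp
  finally show ?thesis .
qed

lemma AE_unit_circle_measure: "AE x in unit_circle_measure. norm x = 1"
  unfolding unit_circle_measure_def by (subst AE_distr_iff) auto

text \<open>
  The hypotheses only force \<open>f p\<close> to have absolute value \<open>1\<close> almost surely; we correct it on the
  exceptional null set.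
\<close>

definition unimodular_part :: "complex \<Rightarrow> complex" where
  "unimodular_part x = (if norm x = 1 then x else 1)"

lemma borel_measurable_unimodular_part [measurable]: "unimodular_part \<in> borel_measurable borel"
  unfolding unimodular_part_def [abs_def] by measurable

text \<open>The correction is a measurable function of \<open>f p\<close>, so independence is
  inherited, and it changes neither the moments nor, outside a countable union of null sets, any
  value \<open>f n\<close>.\<close>

lemma steinhaus_imp_steinhaus_primes:
  assumes "steinhaus M f"
  shows "steinhaus_primes M (\<lambda>p \<omega>. unimodular_part (f p \<omega>))"
    and "AE \<omega> in M. \<forall>n>0. f n \<omega> = mult_ext (\<lambda>p. unimodular_part (f p \<omega>)) n"
proof -
  from assms have M: "prob_space M"
    and ind: "prob_space.indep_vars M (\<lambda>_. borel) f {p. prime p}"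
    and dist: "\<And>p. prime p \<Longrightarrow> distr M borel (f p) = unit_circle_measure"
    and f: "\<And>n \<omega>. n > 0 \<Longrightarrow> \<omega> \<in> space M \<Longrightarrow> f n \<omega> = mult_ext (\<lambda>p. f p \<omega>) n"
    unfolding steinhaus_def mult_ext_def by blast+
  interpret prob_space M by (rule M)
  have fm: "random_variable borel (f p)" if "prime p" for p
    using ind that by (auto simp: indep_vars_def)
  have AE1: "AE \<omega> in M. norm (f p \<omega>) = 1" if "prime p" for p
  proof -
    have "AE x in distr M borel (f p). norm x = 1"
      unfolding dist[OF that] by (rule AE_unit_circle_measure)
    then show ?thesis using fm[OF that] by (subst (asm) AE_distr_iff) auto
  qed
  have "AE \<omega> in M. \<forall>p. prime p \<longrightarrow> norm (f p \<omega>) = 1"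
    using AE1 by (auto simp: AE_all_countable)
  then show "AE \<omega> in M. \<forall>n>0. f n \<omega> = mult_ext (\<lambda>p. unimodular_part (f p \<omega>)) n"
    using AE_space
  proof eventually_elim
    case (elim \<omega>)
    then have "mult_ext (\<lambda>p. f p \<omega>) n = mult_ext (\<lambda>p. unimodular_part (f p \<omega>)) n" for n
      by (intro mult_ext_cong) (simp add: unimodular_part_def)
    then show ?case using f elim by simp
  qed
  show "steinhaus_primes M (\<lambda>p \<omega>. unimodular_part (f p \<omega>))"
  proof unfold_locales
    show "indep_vars (\<lambda>_. borel) (\<lambda>p \<omega>. unimodular_part (f p \<omega>)) {p. prime p}"
      by (rule indep_vars_compose2[OF ind]) measurable
    show "norm (unimodular_part (f p \<omega>)) = 1" for p \<omega> by (simp add: unimodular_part_def)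
    fix p k :: nat assume p: "prime p" and k: "k > 0"
    have "expectation (\<lambda>\<omega>. unimodular_part (f p \<omega>) ^ k) = expectation (\<lambda>\<omega>. f p \<omega> ^ k)"
    proof (rule integral_cong_AE)
      show "AE \<omega> in M. unimodular_part (f p \<omega>) ^ k = f p \<omega> ^ k"
        using AE1[OF p] by eventually_elim (simp add: unimodular_part_def)
    qed (use fm[OF p] in measurable)
    also have "\<dots> = integral\<^sup>L (distr M borel (f p)) (\<lambda>x. x ^ k)"
      using fm[OF p] by (subst integral_distr) auto
    also have "\<dots> = 0" unfolding dist[OF p] by (rule moments_unit_circle_measure[OF k])
    finally show "expectation (\<lambda>\<omega>. unimodular_part (f p \<omega>) ^ k) = 0" .
  qed
qed

theorem theorem2:
  fixes M :: "'a measure" and f :: "nat \<Rightarrow> 'a \<Rightarrow> complex" and \<epsilon> :: real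
  assumes "steinhaus M f" and "\<epsilon> > 0"
  shows "AE \<omega> in M.
    Limsup at_top (\<lambda>x::real.
      ereal (norm (weighted_sum (\<lambda>n. f n \<omega>) x) /
             exp ((1 - \<epsilon>) * sqrt (iter_ln 2 x * iter_ln 4 x)))) \<ge> 1"
proof -
  interpret steinhaus_primes M "\<lambda>p \<omega>. unimodular_part (f p \<omega>)"
    by (rule steinhaus_imp_steinhaus_primes(1)[OF assms(1)])
  \<comment> \<open>Replacing \<open>\<epsilon>\<close> by a smaller value only strengthens the
    claim, and the summation lemmas need a value below 1.\<close>
  define e where "e = min \<epsilon> (1 / 2)"
  have e: "0 < e" "e < 1" "e \<le> \<epsilon>" using assms(2) by (auto simp: e_def)
  from not_eventually_partial_sums_small[OF e(1,2)] steinhaus_imp_steinhaus_primes(2)[OF assms(1)]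
  show ?thesis
  proof eventually_elim
    case (elim \<omega>)
    define R where "R x = norm (weighted_sum (\<lambda>n. f n \<omega>) x) / exp ((1 - \<epsilon>) * sqrt (iter_ln 2 x * iter_ln 4 x))" for x
    have it: "iter_ln 2 x = ln (ln x)" "iter_ln 4 x = ln (ln (ln (ln x)))" for x
      by (simp_all add: iter_ln_def eval_nat_numeral)
    have ws: "weighted_sum (\<lambda>n. f n \<omega>) (real n)
        = (\<Sum>j\<in>{1..n}. mult_ext (\<lambda>p. unimodular_part (f p \<omega>)) j / of_real (sqrt (real j)))" for n
    proof -
      have "{j. 0 < j \<and> real j \<le> real n} = {1..n}" by auto
      then show ?thesis unfolding weighted_sum_def using elim(2) by (auto intro!: sum.cong)
    qed
    have "\<not> Limsup at_top (\<lambda>x. ereal (R x)) < 1"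
    proof
      assume "Limsup at_top (\<lambda>x. ereal (R x)) < 1"
      then have "\<forall>\<^sub>F x in at_top. ereal (R x) < 1" by (rule Limsup_lessD)
      then have "\<forall>\<^sub>F n in sequentially. ereal (R (real n)) < 1"
        by (rule eventually_compose_filterlim[OF _ filterlim_real_sequentially])
      \<comment> \<open>A positive product makes \<open>sqrt\<close> nonnegative, without which
        passing from \<open>1 - \<epsilon>\<close> to \<open>1 - e\<close> would not be monotone:
        \<open>sqrt\<close> is negative at negative arguments.\<close>
      moreover have "\<forall>\<^sub>F n in sequentially. ln (ln (real n)) * ln (ln (ln (ln (real n)))) > 0"
        by real_asymp
      ultimately have "\<forall>\<^sub>F n in sequentially.
        norm (\<Sum>j\<in>{1..n}. mult_ext (\<lambda>p. unimodular_part (f p \<omega>)) j / of_real (sqrt (real j)))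
          \<le> exp ((1 - e) * sqrt (ln (ln (real n)) * ln (ln (ln (ln (real n))))))"
      proof eventually_elim
        case (elim n)
        from elim(1) have "norm (weighted_sum (\<lambda>n. f n \<omega>) (real n))
            \<le> exp ((1 - \<epsilon>) * sqrt (ln (ln (real n)) * ln (ln (ln (ln (real n))))))"
          by (simp add: R_def it divide_less_eq)
        also have "\<dots> \<le> exp ((1 - e) * sqrt (ln (ln (real n)) * ln (ln (ln (ln (real n))))))"
          using elim(2) e(3) by (simp add: mult_right_mono)
        finally show ?case unfolding ws .
      qed
      with elim(1) show False by contradiction
    qed
    then show ?case by (simp add: R_def not_less)
  qed
qed

end
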